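(* Let $f(x,y)\in\mathbb{C}[x,y]$ be a complex bivariate polynomial written as $f=\sum_{i=0}^n f_i(x)y^i$, where $f_i\in\mathbb{C}[x]$ and $f_0,f_n$ are nonzero polynomials. Suppose that $f$ is reduced, i.e., no irreducible factor appears multiple times. Write $\hat f\in\mathbb{C}[x,\tilde x,y,\tilde y]$ for the multi-homogenization of $f$. Then the following are equivalent: (A) $f$ is quasi-homogeneous where the weight of $x$ is non-zero; (B) $f_0$, $f_n$ and $\mathrm{Disc}_y(f)$ are (non-zero) monomials (in $x$); (C) the sub-varieties of $\mathbb{P}^1\times\mathbb{P}^1$ defined by $\hat f$ and $y\hat f_y$ have no common point within $\mathbb{C}^\times\times\mathbb{P}^1$ (where $\hat f_y$ denotes the derivative of $\hat f$ with respect to the variable $y$).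
   Context: Here $\mathbb{P}^1=\mathbb{P}^1(\mathbb{C})=\mathbb{C}\cup\{\infty\}$ is the one-dimensional projective space over $\mathbb{C}$, with $a\in\mathbb{C}$ identified with $[a:1]$, and $\mathbb{C}^\times=\mathbb{C}\setminus\{0\}$. Varieties are identified with their $\mathbb{C}$-valued points and need not be irreducible. Quasi-homogeneous: $f=\sum c_{ij}x^iy^j$ is quasi-homogeneous if there are integers $w,\alpha,\beta$ with $\alpha,\beta$ not both equal to $0$ such that $w=\alpha i+\beta j$ for every non-zero monomial $c_{ij}x^iy^j$ of $f$. One calls $\alpha$ and $\beta$ the weights of $x$ and $y$, respectively; negative weights are allowed. Multi-homogenization: for $f=\sum a_{ij}x^iy^j$ of degree $m$ in $x$ and $n$ in $y$, $\hat f(x,\tilde x,y,\tilde y)=\sum a_{ij}x^i\tilde x^{m-i}y^j\tilde y^{n-j}$. A polynomial in $x,\tilde x,y,\tilde y$ that is homogeneous separately in $(x,\tilde x)$ and in $(y,\tilde y)$ defines a sub-variety of $\mathbb{P}^1\times\mathbb{P}^1$, namely its zero set in the coordinates $([x:\tilde x],[y:\tilde y])$. Discriminant: for $f\in\mathbb{C}[x,y]\setminus\mathbb{C}[x]$, with $n=\deg_y f$ and $f_n\in\mathbb{C}[x]$ the $y^n$-coefficient of $f$, the discriminant of $f$ with respect to $y$ is the polynomial $\mathrm{Disc}_y(f)\in\mathbb{C}[x]$ such that for every $a\in\mathbb{C}$, $\mathrm{Disc}_y(f)(a)=f_n^{2n-2}(a)\prod_{i<j}(b_i-b_j)^2$,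 where the $b_i$ are the roots of $f(a,y)$. (For $n=1$, one sets $\mathrm{Disc}_y(f)=1$.) *)

theory Defs
  imports "HOL-Computational_Algebra.Computational_Algebra" Complex_Main
begin

text \<open>
  A polynomial $f \in \mathbb{C}[x,y]$ is an element of \<^typ>\<open>complex poly poly\<close>: the outer
  variable is $y$, the inner one is $x$. So the coefficient of $x^i y^j$ in $f$ is
  \<open>coeff (coeff f j) i\<close>, and \<open>degree f\<close> is the degree in $y$.
\<close>

definition reduced :: "complex poly poly \<Rightarrow> bool" where
  "reduced f \<longleftrightarrow> (\<forall>p. irreducible p \<longrightarrow> \<not> p ^ 2 dvd f)"

definition quasi_homogeneous :: "complex poly poly \<Rightarrow> int \<Rightarrow> int \<Rightarrow> bool" where
  "quasi_homogeneous f \<alpha> \<beta> \<longleftrightarrow> (\<alpha> \<noteq> 0 \<or> \<beta> \<noteq> 0) \<and>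
     (\<exists>w::int. \<forall>i j. coeff (coeff f j) i \<noteq> 0 \<longrightarrow> w = \<alpha> * int i + \<beta> * int j)"

definition nonzero_monomial :: "complex poly \<Rightarrow> bool" where
  "nonzero_monomial p \<longleftrightarrow> (\<exists>c k. c \<noteq> 0 \<and> p = monom c k)"

definition degree_x :: "complex poly poly \<Rightarrow> nat" where
  "degree_x f = Max ((\<lambda>j. degree (coeff f j)) ` {..degree f})"

definition specialize_x :: "complex poly poly \<Rightarrow> complex \<Rightarrow> complex poly" where
  "specialize_x f a = map_poly (\<lambda>c. poly c a) f"

text \<open>
  The product formula for the discriminant is required only where the leading coefficient in $y$
  does not vanish: where it vanishes, $f(a,y)$ has fewer than $n$ roots and the formula
  is not meaningful (for $n = 2$ the discriminant $f_1^2 - 4 f_0 f_2$ takes the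
  value $f_1(a)^2$ there). Since this leaves out only finitely many points, it still determines
  the polynomial. The list \<open>bs\<close> enumerates the roots with multiplicity.
\<close>

definition is_discriminant :: "complex poly poly \<Rightarrow> complex poly \<Rightarrow> bool" where
  "is_discriminant f D \<longleftrightarrow>
     (\<forall>a bs. poly (lead_coeff f) a \<noteq> 0 \<longrightarrow>
        specialize_x f a = smult (poly (lead_coeff f) a) (\<Prod>b\<leftarrow>bs. [:- b, 1:]) \<longrightarrow>
        poly D a = poly (lead_coeff f) a ^ (2 * degree f - 2) *
                   (\<Prod>j<length bs. \<Prod>i<j. (bs ! i - bs ! j) ^ 2))"

text \<open>The value \<open>1\<close> is a convention for $n = 1$, extended here to $n = 0$.\<close>

definition Disc_y :: "complex poly poly \<Rightarrow> complex poly" where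
  "Disc_y f = (if degree f \<le> 1 then 1 else (THE D. is_discriminant f D))"

text \<open>
  Polynomials in $x, \tilde x, y, \tilde y$ are nested in the order $x$ (innermost), $\tilde x$,
  $\tilde y$, $y$ (outermost), so that the partial derivative with respect to $y$ is
  \<^const>\<open>pderiv\<close> and multiplication by $y$ is multiplication by \<open>[:0, 1:]\<close>.
\<close>

type_synonym poly4 = "complex poly poly poly poly"

definition eval4 :: "poly4 \<Rightarrow> complex \<Rightarrow> complex \<Rightarrow> complex \<Rightarrow> complex \<Rightarrow> complex" where
  "eval4 F x x' y y' = poly (poly (poly (poly F [:[:[:y:]:]:]) [:[:y':]:]) [:x':]) x"

definition multi_homogenization :: "complex poly poly \<Rightarrow> poly4" where
  "multi_homogenization f =
     (let m = degree_x f; n = degree f in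
      \<Sum>j\<le>n. \<Sum>i\<le>m.
        monom (monom (monom (monom (coeff (coeff f j) i) i) (m - i)) (n - j)) j)"

definition proportional :: "complex \<times> complex \<Rightarrow> complex \<times> complex \<Rightarrow> bool" where
  "proportional p q \<longleftrightarrow> p \<noteq> (0, 0) \<and> q \<noteq> (0, 0) \<and>
     (\<exists>c. c \<noteq> 0 \<and> q = (c * fst p, c * snd p))"

lemma part_equivp_proportional: "part_equivp proportional"
proof (rule part_equivpI)
  show "\<exists>p. proportional p p"
    by (rule exI[of _ "(1, 1)"]) (auto simp: proportional_def)
  show "symp proportional"
  proof (rule sympI)
    fix p q assume "proportional p q"
    then obtain c where c: "c \<noteq> 0" "q = (c * fst p, c * snd p)" "p \<noteq> (0, 0)" "q \<noteq> (0, 0)"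
      unfolding proportional_def by blast
    then have "p = (inverse c * fst q, inverse c * snd q)"
      by (simp add: prod_eq_iff)
    with c show "proportional q p"
      unfolding proportional_def by (metis inverse_nonzero_iff_nonzero)
  qed
  show "transp proportional"
  proof (rule transpI)
    fix p q r assume "proportional p q" "proportional q r"
    then obtain c d where cd: "c \<noteq> 0" "q = (c * fst p, c * snd p)" "p \<noteq> (0, 0)"
      "d \<noteq> 0" "r = (d * fst q, d * snd q)" "r \<noteq> (0, 0)"
      unfolding proportional_def by blast
    then have "d * c \<noteq> 0" "r = (d * c * fst p, d * c * snd p)"
      by (simp_all add: mult.assoc)
    with cd show "proportional p r"
      unfolding proportional_def by blast
  qed
qed

quotient_type cp1 = "complex \<times> complex" / partial: proportional
  by (rule part_equivp_proportional)

text \<open>The point $[u:v]$; meaningful only for $(u,v) \neq (0,0)$.\<close>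

definition hpoint :: "complex \<Rightarrow> complex \<Rightarrow> cp1" where
  "hpoint u v = abs_cp1 (u, v)"

lemma hpoint_eq_iff:
  assumes "(u, v) \<noteq> (0, 0)" "(u', v') \<noteq> (0, 0)"
  shows "hpoint u v = hpoint u' v' \<longleftrightarrow> (\<exists>c. c \<noteq> 0 \<and> u' = c * u \<and> v' = c * v)"
proof -
  have refl: "proportional p p" if "p \<noteq> (0, 0)" for p
    using that unfolding proportional_def by (auto intro!: exI[of _ 1])
  have "hpoint u v = hpoint u' v' \<longleftrightarrow> proportional (u, v) (u', v')"
    unfolding hpoint_def using Quotient_rel[OF Quotient_cp1, of "(u, v)" "(u', v')"] refl assms
    by blast
  then show ?thesis
    using assms by (simp add: proportional_def)
qed

lemma hpoint_cases:
  obtains u v where "(u, v) \<noteq> (0, 0)" "P = hpoint u v"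
proof -
  have "proportional (rep_cp1 P) (rep_cp1 P)"
    by (rule Quotient_rep_reflp[OF Quotient_cp1])
  moreover have "P = abs_cp1 (rep_cp1 P)"
    by (simp add: Quotient_abs_rep[OF Quotient_cp1])
  ultimately show ?thesis
    using that[of "fst (rep_cp1 P)" "snd (rep_cp1 P)"]
    by (simp add: hpoint_def proportional_def)
qed

text \<open>$\mathbb{C}^\times \subset \mathbb{P}^1$, with $a$ identified with $[a:1]$.\<close>

definition cp1_Cstar :: "cp1 set" where
  "cp1_Cstar = {hpoint a 1 | a. a \<noteq> 0}"

text \<open>
  For \<open>F\<close> homogeneous separately in $(x,\tilde x)$ and in $(y,\tilde y)$, whether a point lies in the
  following set does not depend on the choice of its homogeneous coordinates.
\<close>

definition subvariety :: "poly4 \<Rightarrow> (cp1 \<times> cp1) set" where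
  "subvariety F = {(hpoint x x', hpoint y y') | x x' y y'.
     (x, x') \<noteq> (0, 0) \<and> (y, y') \<noteq> (0, 0) \<and> eval4 F x x' y y' = 0}"

end

theory Submission
  imports Defs "HOL-Computational_Algebra.Field_as_Ring" "HOL-Complex_Analysis.Great_Picard"
    "Jordan_Normal_Form.Determinant"
begin

hide_const (open) Module.smult Brouwer_Fixpoint.reduced

text \<open>
  All three conditions are equivalent to: for every $a \neq 0$, the polynomial $f(a, y)$ has
  exactly \<open>degree f\<close> roots, all simple and nonzero. For (C) this is a case distinction on the
  points of the fibre over $a$, and for (B) it is the meaning of the discriminant, whose existence
  as a polynomial comes from a Bezout determinant.

  If $f$ is quasi-homogeneous, the torus action $(x, y) \mapsto (t^\alpha x, t^\beta y)$ makes
  all fibres over $\mathbb{C}^\times$ alike, and a reduced $f$ has a separable fibre because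
  $f$ and $f_y$ generate an ideal containing a nonzero polynomial in $x$.

  Conversely, pull the curve back along $x = e^z$. Its roots form a covering of the simply
  connected plane, so they are given by entire functions $b_1, \dots, b_n$. The quotients
  $b_i / b_j$ omit $0$ and $1$, so by Picard's theorem they are constant. Hence
  $f_j(e^z)$ is a constant multiple of $f_n(e^z) b_1(z)^{n-j}$, where $b_1^n$ is a constant multiple
  of the quotient of the monomials $f_0$ and $f_n$, and the exponents of $f$ lie on a line.
\<close>

section \<open>Fibres and common points\<close>

text \<open>Over the complex numbers a polynomial splits, and if 0 is its only possible root, every
  linear factor is x.\<close>

lemma nonzero_monomial_iff:
  "nonzero_monomial p \<longleftrightarrow> p \<noteq> 0 \<and> (\<forall>a. a \<noteq> 0 \<longrightarrow> poly p a \<noteq> 0)"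
proof
  assume "nonzero_monomial p"
  then show "p \<noteq> 0 \<and> (\<forall>a. a \<noteq> 0 \<longrightarrow> poly p a \<noteq> 0)"
    by (auto simp: nonzero_monomial_def poly_monom)
next
  assume p: "p \<noteq> 0 \<and> (\<forall>a. a \<noteq> 0 \<longrightarrow> poly p a \<noteq> 0)"
  obtain root where root: "smult (lead_coeff p) (\<Prod>i<degree p. [:- root i, 1:]) = p"
    by (rule complex_poly_decompose')
  have "root i = 0" if "i < degree p" for i
  proof -
    have "poly p (root i) = 0"
      by (subst root [symmetric]) (use that in \<open>auto simp: poly_prod\<close>)
    with p show ?thesis by blast
  qed
  then have "(\<Prod>i<degree p. [:- root i, 1:]) = (\<Prod>i<degree p. [:0, 1:])"
    by (intro prod.cong) auto
  then have "p = monom (lead_coeff p) (degree p)"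
    using root by (simp add: monom_altdef)
  with p show "nonzero_monomial p"
    unfolding nonzero_monomial_def by (metis leading_coeff_0_iff)
qed

lemma poly_specialize_x [simp]: "poly (specialize_x f a) b = poly (poly f [:b:]) a"
  unfolding specialize_x_def by (induction f) (simp_all add: map_poly_pCons)

lemma coeff_specialize_x [simp]: "coeff (specialize_x f a) j = poly (coeff f j) a"
  by (simp add: specialize_x_def coeff_map_poly)

lemma pderiv_specialize_x: "pderiv (specialize_x f a) = specialize_x (pderiv f) a"
  by (simp add: poly_eq_iff coeff_pderiv)

lemma degree_specialize_x:
  assumes "poly (lead_coeff f) a \<noteq> 0"
  shows "degree (specialize_x f a) = degree f"
  using assms by (intro antisym degree_le le_degree) (auto simp: coeff_eq_0)

text \<open>The three clauses keep the fibre over a away from 0, away from infinity, and free of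
  multiple points.\<close>

definition unramified :: "complex poly poly \<Rightarrow> bool" where
  "unramified f \<longleftrightarrow> (\<forall>a. a \<noteq> 0 \<longrightarrow> poly (coeff f 0) a \<noteq> 0 \<and> poly (lead_coeff f) a \<noteq> 0 \<and>
     rsquarefree (specialize_x f a))"

section \<open>Evaluation of the multi-homogenization in homogeneous coordinates\<close>

lemma eval4_add [simp]: "eval4 (F + G) x x' y y' = eval4 F x x' y y' + eval4 G x x' y y'"
  by (simp add: eval4_def)

lemma eval4_0 [simp]: "eval4 0 x x' y y' = 0"
  by (simp add: eval4_def)

lemma eval4_sum: "eval4 (sum F A) x x' y y' = (\<Sum>i\<in>A. eval4 (F i) x x' y y')"
  by (induction A rule: infinite_finite_induct) auto

lemma eval4_monom:
  "eval4 (monom (monom (monom (monom c i) i') j') j) x x' y y' = c * x ^ i * x' ^ i' * y' ^ j' * y ^ j"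
  by (simp add: eval4_def poly_monom flip: pCons_one)

lemma eval4_pderiv_monom:
  "y * eval4 (pderiv (monom (monom (monom (monom c i) i') j') j)) x x' y y' =
    of_nat j * c * x ^ i * x' ^ i' * y' ^ j' * y ^ j"
  by (cases j) (simp_all add: eval4_def pderiv_monom poly_monom of_nat_poly algebra_simps flip: pCons_one)

text \<open>The operator y d/dy multiplies the term in y^j by j. So \<open>\<phi> j = 1\<close>
  gives the multi-homogenization and \<open>\<phi> j = j\<close> gives y times its
  y-derivative.\<close>

definition bihom :: "(nat \<Rightarrow> complex) \<Rightarrow> complex poly poly \<Rightarrow>
    complex \<Rightarrow> complex \<Rightarrow> complex \<Rightarrow> complex \<Rightarrow> complex" where
  "bihom \<phi> f x x' y y' = (\<Sum>j\<le>degree f. \<Sum>i\<le>degree_x f. \<phi> j * coeff (coeff f j) i *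
     x ^ i * x' ^ (degree_x f - i) * y' ^ (degree f - j) * y ^ j)"

lemma eval4_multi_homogenization:
  "eval4 (multi_homogenization f) x x' y y' = bihom (\<lambda>_. 1) f x x' y y'"
  by (simp add: multi_homogenization_def bihom_def Let_def eval4_sum eval4_monom)

lemma eval4_pderiv_multi_homogenization:
  "eval4 ([:0, 1:] * pderiv (multi_homogenization f)) x x' y y' = bihom of_nat f x x' y y'"
proof -
  have "eval4 ([:0, 1:] * F) x x' y y' = y * eval4 F x x' y y'" for F
    by (simp add: eval4_def)
  then show ?thesis
    by (simp add: multi_homogenization_def bihom_def Let_def eval4_sum
        higher_pderiv_sum [of 1, simplified] sum_distrib_left
        eval4_pderiv_monom)
qed

text \<open>Bihomogeneity, used to exchange different homogeneous coordinates of one point.\<close>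

lemma bihom_scale:
  "bihom \<phi> f (c * x) (c * x') (d * y) (d * y') = c ^ degree_x f * d ^ degree f * bihom \<phi> f x x' y y'"
proof -
  have "(c * x) ^ i * (c * x') ^ (m - i) * (d * y') ^ (n - j) * (d * y) ^ j =
      c ^ m * d ^ n * (x ^ i * x' ^ (m - i) * y' ^ (n - j) * y ^ j)"
    if "i \<le> m" "j \<le> n" for i j m n
  proof -
    have "c ^ m = c ^ i * c ^ (m - i)" "d ^ n = d ^ j * d ^ (n - j)"
      using that by (simp_all flip: power_add)
    then show ?thesis
      by (simp add: power_mult_distrib algebra_simps)
  qed
  then show ?thesis
    unfolding bihom_def sum_distrib_left by (intro sum.cong refl) (simp add: mult.assoc mult.left_commute)
qed

lemma degree_coeff_le_degree_x: "j \<le> degree f \<Longrightarrow> degree (coeff f j) \<le> degree_x f"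
  unfolding degree_x_def by (intro Max_ge) auto

lemma poly_eq_sum_le:
  fixes p :: "'a::comm_semiring_1 poly"
  assumes "degree p \<le> n"
  shows "poly p x = (\<Sum>i\<le>n. coeff p i * x ^ i)"
  by (subst poly_as_sum_of_monoms' [OF assms, symmetric]) (simp add: poly_sum poly_monom)

lemma bihom_affine:
  "bihom \<phi> f a 1 y y' = (\<Sum>j\<le>degree f. \<phi> j * poly (coeff f j) a * y' ^ (degree f - j) * y ^ j)"
  unfolding bihom_def
proof (intro sum.cong refl)
  fix j assume "j \<in> {..degree f}"
  then have "poly (coeff f j) a = (\<Sum>i\<le>degree_x f. coeff (coeff f j) i * a ^ i)"
    by (intro poly_eq_sum_le) (simp add: degree_coeff_le_degree_x)
  then show "(\<Sum>i\<le>degree_x f. \<phi> j * coeff (coeff f j) i * a ^ i * 1 ^ (degree_x f - i) *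
      y' ^ (degree f - j) * y ^ j) = \<phi> j * poly (coeff f j) a * y' ^ (degree f - j) * y ^ j"
    by (simp add: sum_distrib_left sum_distrib_right mult.assoc)
qed

lemma bihom_infinity: "bihom \<phi> f a 1 y 0 = \<phi> (degree f) * poly (lead_coeff f) a * y ^ degree f"
  unfolding bihom_affine by (subst sum.remove [of _ "degree f"]) (auto intro!: sum.neutral)

lemma bihom_finite:
  assumes "y' \<noteq> 0"
  shows "bihom (\<lambda>_. 1) f a 1 y y' = y' ^ degree f * poly (specialize_x f a) (y / y')"
    and "bihom of_nat f a 1 y y' = y' ^ degree f * (y / y' * poly (pderiv (specialize_x f a)) (y / y'))"
proof -
  let ?p = "specialize_x f a"
  have deg: "degree ?p \<le> degree f"
    by (intro degree_le) (auto simp: coeff_eq_0)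
  have *: "bihom \<phi> f a 1 y y' = y' ^ degree f * poly q (y / y')"
    if "degree q \<le> degree f" "\<And>j. coeff q j = \<phi> j * coeff ?p j" for \<phi> q
    unfolding bihom_affine poly_eq_sum_le [OF that(1)] sum_distrib_left that(2)
    using assms by (intro sum.cong refl) (simp add: power_diff power_divide)
  show "bihom (\<lambda>_. 1) f a 1 y y' = y' ^ degree f * poly ?p (y / y')"
    using deg by (intro *) auto
  have "degree (pCons 0 (pderiv ?p)) \<le> degree f"
    using deg by (intro degree_le) (auto simp: coeff_pCons coeff_pderiv coeff_eq_0 split: nat.splits)
  then have "bihom of_nat f a 1 y y' = y' ^ degree f * poly (pCons 0 (pderiv ?p)) (y / y')"
    by (intro *) (auto simp: coeff_pCons coeff_pderiv split: nat.splits)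
  then show "bihom of_nat f a 1 y y' = y' ^ degree f * (y / y' * poly (pderiv ?p) (y / y'))"
    by simp
qed

text \<open>On the fibre over a, both forms vanish at [1:0] exactly if the leading coefficient does,
  at [0:1] exactly if the constant coefficient does, and at [b:1] with b nonzero exactly if b is a
  common root of f(a,y) and its derivative.\<close>

lemma unramified_iff_bihom:
  "unramified f \<longleftrightarrow> (\<forall>a y y'. a \<noteq> 0 \<longrightarrow> (y, y') \<noteq> (0, 0) \<longrightarrow>
     bihom (\<lambda>_. 1) f a 1 y y' = 0 \<longrightarrow> bihom of_nat f a 1 y y' \<noteq> 0)"
  (is "_ \<longleftrightarrow> ?rhs")
proof
  assume f: "unramified f"
  show ?rhs
  proof (intro allI impI)
    fix a y y' :: complex
    assume "a \<noteq> 0" and y: "(y, y') \<noteq> (0, 0)" and zero: "bihom (\<lambda>_. 1) f a 1 y y' = 0"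
    with f have *: "poly (coeff f 0) a \<noteq> 0" "poly (lead_coeff f) a \<noteq> 0"
        "rsquarefree (specialize_x f a)"
      by (auto simp: unramified_def)
    then have "y' \<noteq> 0"
      using zero y by (auto simp: bihom_infinity)
    then have root: "poly (specialize_x f a) (y / y') = 0"
      using zero by (simp add: bihom_finite(1) del: poly_specialize_x)
    moreover have "y \<noteq> 0"
    proof
      assume "y = 0"
      with root have "coeff (specialize_x f a) 0 = 0"
        by (simp add: poly_0_coeff_0 del: poly_specialize_x coeff_specialize_x)
      with * show False by simp
    qed
    ultimately show "bihom of_nat f a 1 y y' \<noteq> 0"
      using *(3) \<open>y' \<noteq> 0\<close> by (auto simp: bihom_finite(2) rsquarefree_roots simp del: poly_specialize_x)
  qed
next
  assume rhs: ?rhs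
  show "unramified f"
    unfolding unramified_def
  proof (intro allI impI conjI)
    fix a :: complex assume "a \<noteq> 0"
    note * = rhs [rule_format, OF this]
    show "poly (lead_coeff f) a \<noteq> 0"
      using * [of 1 0] by (auto simp: bihom_infinity)
    show "poly (coeff f 0) a \<noteq> 0"
      using * [of 0 1] by (auto simp: bihom_finite poly_0_coeff_0)
    show "rsquarefree (specialize_x f a)"
      using * [of _ 1] by (auto simp: bihom_finite rsquarefree_roots simp del: poly_specialize_x)
  qed
qed

lemma no_common_point_iff_unramified:
  "subvariety (multi_homogenization f) \<inter> subvariety ([:0, 1:] * pderiv (multi_homogenization f))
     \<inter> (cp1_Cstar \<times> UNIV) = {} \<longleftrightarrow> unramified f"
  (is "?C = {} \<longleftrightarrow> _")
proof
  assume "?C = {}"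
  show "unramified f"
    unfolding unramified_iff_bihom
  proof (intro allI impI notI)
    fix a y y' :: complex
    assume "a \<noteq> 0" "(y, y') \<noteq> (0, 0)" "bihom (\<lambda>_. 1) f a 1 y y' = 0" "bihom of_nat f a 1 y y' = 0"
    moreover have "(a, 1 :: complex) \<noteq> (0, 0)" by simp
    ultimately have "(hpoint a 1, hpoint y y') \<in> ?C"
      unfolding subvariety_def cp1_Cstar_def eval4_multi_homogenization
        eval4_pderiv_multi_homogenization by blast
    with \<open>?C = {}\<close> show False by simp
  qed
next
  assume f: "unramified f"
  show "?C = {}"
  proof (rule equals0I)
    fix P assume "P \<in> ?C"
    then obtain x x' y y' where
      P1: "P = (hpoint x x', hpoint y y')" "(x, x') \<noteq> (0, 0)" "(y, y') \<noteq> (0, 0)" and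
      zero1: "bihom (\<lambda>_. 1) f x x' y y' = 0"
      unfolding subvariety_def eval4_multi_homogenization by blast
    from \<open>P \<in> ?C\<close> obtain u u' v v' where
      P2: "P = (hpoint u u', hpoint v v')" "(u, u') \<noteq> (0, 0)" "(v, v') \<noteq> (0, 0)" and
      zero2: "bihom of_nat f u u' v v' = 0"
      unfolding subvariety_def eval4_pderiv_multi_homogenization by blast
    from \<open>P \<in> ?C\<close> obtain a where P3: "fst P = hpoint a 1" "a \<noteq> 0"
      unfolding cp1_Cstar_def by force
    have "hpoint x x' = hpoint a 1" "hpoint u u' = hpoint a 1" "hpoint v v' = hpoint y y'"
      using P1(1) P2(1) P3(1) by auto
    \<comment> \<open>Each membership comes with its own coordinates of the same point; these
      factors rescale all of them to ([a:1], [y:y']).\<close>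
    then obtain c d e where
      "a = c * x" "1 = c * x'" "a = d * u" "1 = d * u'" "y = e * v" "y' = e * v'"
      using hpoint_eq_iff [OF P1(2)] hpoint_eq_iff [OF P2(2)] hpoint_eq_iff [OF P2(3) P1(3)]
      by (metis prod.inject zero_neq_one)
    then have "bihom (\<lambda>_. 1) f a 1 y y' = c ^ degree_x f * 1 ^ degree f * bihom (\<lambda>_. 1) f x x' y y'"
      and "bihom of_nat f a 1 y y' = d ^ degree_x f * e ^ degree f * bihom of_nat f u u' v v'"
      by (metis bihom_scale mult_1, metis bihom_scale)
    then show False
      using f P1(3) P3(2) zero1 zero2 unfolding unramified_iff_bihom by simp
  qed
qed

section \<open>Quasi-homogeneity\<close>

text \<open>Write f = p q. Then p divides q p', but for positive degree in y it cannot divide the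
  nonzero p' of smaller degree, so p divides q and its square divides f.\<close>

lemma reduced_coprime_pderiv:
  assumes "reduced f" "irreducible p" "p dvd f" "p dvd pderiv f"
  shows "degree p = 0"
proof (rule ccontr)
  assume "degree p \<noteq> 0"
  from \<open>p dvd f\<close> obtain q where q: "f = p * q" ..
  have "prime_elem p"
    using \<open>irreducible p\<close> by (rule irreducible_imp_prime_elem)
  have "p dvd p * pderiv q + q * pderiv p"
    using \<open>p dvd pderiv f\<close> by (simp add: q pderiv_mult)
  then have "p dvd q * pderiv p"
    by (simp add: dvd_add_right_iff)
  moreover have "\<not> p dvd pderiv p"
  proof
    assume "p dvd pderiv p"
    moreover have "pderiv p \<noteq> 0"
      using \<open>degree p \<noteq> 0\<close> by (simp add: pderiv_eq_0_iff)
    ultimately have "degree p \<le> degree (pderiv p)"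
      by (rule dvd_imp_degree_le)
    with \<open>degree p \<noteq> 0\<close> show False
      by (simp add: degree_pderiv)
  qed
  ultimately have "p dvd q"
    using \<open>prime_elem p\<close> by (auto simp: prime_elem_dvd_mult_iff)
  then have "p ^ 2 dvd f"
    by (simp add: q power2_eq_square)
  with assms(1,2) show False
    by (auto simp: Defs.reduced_def)
qed

text \<open>Degrees in y add up over the prime factors, so one of them has positive degree.\<close>

lemma irreducible_factor_pos_degree:
  fixes p :: "complex poly poly"
  assumes "degree p > 0"
  shows "\<exists>q. irreducible q \<and> q dvd p \<and> degree q > 0"
  using assms
proof (induction p rule: prime_divisors_induct)
  case (factor q p)
  have nz: "q \<noteq> 0" "p \<noteq> 0"
    using factor.prems by auto
  show ?case
  proof (cases "degree q > 0")
    case True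
    then show ?thesis
      using factor.hyps by (intro exI [of _ q]) (auto intro: prime_elem_imp_irreducible)
  next
    case False
    then have "degree p > 0"
      using factor.prems nz by (simp add: degree_mult_eq)
    then show ?thesis
      using factor.IH by (metis dvd_mult)
  qed
qed (auto simp: is_unit_poly_iff)

text \<open>A nonzero element of least degree in the ideal \<open>(f, pderiv f)\<close> divides both generators
  up to a factor from $\mathbb{C}[x]$, by pseudo-division.\<close>

lemma reduced_bezout:
  assumes "reduced f" "f \<noteq> 0"
  obtains u v r where "u * f + v * pderiv f = [:r:]" "r \<noteq> 0"
proof -
  define I where "I = {u * f + v * pderiv f | u v. True} - {0}"
  have "f = 1 * f + 0 * pderiv f"
    by simp
  then have "f \<in> I"
    using \<open>f \<noteq> 0\<close> unfolding I_def by blast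
  then obtain p where "p \<in> I" and min: "\<And>q. q \<in> I \<Longrightarrow> degree p \<le> degree q"
    using ex_has_least_nat [of "\<lambda>p. p \<in> I" f degree] by blast
  then obtain u v where p: "p = u * f + v * pderiv f" "p \<noteq> 0"
    unfolding I_def by blast
  have dvd: "\<exists>c. c \<noteq> 0 \<and> p dvd [:c:] * g" if "g = s * f + t * pderiv f" for g s t
  proof -
    obtain c q where c: "c \<noteq> 0" "smult c g = p * q + pseudo_mod g p"
      using pseudo_mod(1) [OF \<open>p \<noteq> 0\<close>] by blast
    have "pseudo_mod g p = smult c g - p * q"
      by (simp add: c)
    also have "\<dots> = ([:c:] * s - q * u) * f + ([:c:] * t - q * v) * pderiv f"
      by (simp add: that p smult_add_right algebra_simps)
    finally have "pseudo_mod g p \<in> I" if "pseudo_mod g p \<noteq> 0"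
      using that unfolding I_def by blast
    then have "pseudo_mod g p = 0"
      using pseudo_mod(2) [OF \<open>p \<noteq> 0\<close>] min by fastforce
    then show ?thesis
      using c by (intro exI [of _ c]) simp
  qed
  \<comment> \<open>A factor q of p of positive degree in y divides c g but not the nonzero c from
    C[x], hence divides every g in the ideal, in particular f and \<open>pderiv f\<close>.\<close>
  have "degree p = 0"
  proof (rule ccontr)
    assume "degree p \<noteq> 0"
    then obtain q where q: "irreducible q" "q dvd p" "degree q > 0"
      using irreducible_factor_pos_degree by blast
    have "prime_elem q"
      using q(1) by (rule irreducible_imp_prime_elem)
    have "q dvd g" if g: "g = s * f + t * pderiv f" for g s t
    proof -
      obtain c where c: "c \<noteq> 0" "p dvd [:c:] * g"
        using dvd [OF g] by blast
      have "\<not> q dvd [:c:]"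
        using dvd_imp_degree_le [of q "[:c:]"] q(3) c(1) by auto
      moreover have "q dvd [:c:] * g"
        using q(2) c(2) by (rule dvd_trans)
      ultimately show ?thesis
        using prime_elem_dvd_multD [OF \<open>prime_elem q\<close>] by blast
    qed
    from this [of f 1 0] this [of "pderiv f" 0 1] have "q dvd f" "q dvd pderiv f"
      by simp_all
    then have "degree q = 0"
      by (rule reduced_coprime_pderiv [OF \<open>reduced f\<close> q(1)])
    with q(3) show False by simp
  qed
  then obtain r where "p = [:r:]"
    by (rule degree_eq_zeroE)
  then show ?thesis
    using that [of u v r] p by auto
qed


section \<open>Square-free fibres and their transport by the torus action\<close>

lemma ex_nonzero_nonroot:
  fixes p :: "complex poly"
  assumes "p \<noteq> 0"
  obtains a where "a \<noteq> 0" "poly p a \<noteq> 0"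
proof -
  have "[:0, 1:] * p \<noteq> 0"
    using assms by simp
  then obtain a where "poly ([:0, 1:] * p) a \<noteq> 0"
    using poly_all_0_iff_0 by blast
  then show ?thesis
    using that [of a] by auto
qed

text \<open>A common root of f(a,y) and its derivative forces r(a) = 0 in the Bezout identity, so
  any nonzero a that is not a root of r works.\<close>

lemma reduced_ex_rsquarefree:
  assumes "reduced f" "f \<noteq> 0"
  obtains a where "a \<noteq> 0" "rsquarefree (specialize_x f a)"
proof -
  obtain u v r where bez: "u * f + v * pderiv f = [:r:]" "r \<noteq> 0"
    using reduced_bezout [OF assms] .
  obtain a where a: "a \<noteq> 0" "poly r a \<noteq> 0"
    using ex_nonzero_nonroot [OF bez(2)] .
  have "rsquarefree (specialize_x f a)"
    unfolding rsquarefree_roots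
  proof (intro allI notI)
    fix b assume "poly (specialize_x f a) b = 0 \<and> poly (pderiv (specialize_x f a)) b = 0"
    then have "poly (poly (u * f + v * pderiv f) [:b:]) a = 0"
      by (simp add: pderiv_specialize_x)
    with a show False
      unfolding bez by simp
  qed
  with a that show ?thesis by blast
qed

text \<open>On every monomial of f the factor t^(\<alpha> i) equals t^w t^(-\<beta> j), so moving a
  to a' multiplies \<open>coeff f j\<close> by a constant times a j-th power.\<close>

lemma quasi_homogeneous_rescale:
  assumes "quasi_homogeneous f \<alpha> \<beta>" "\<alpha> \<noteq> 0" "a \<noteq> 0" "a' \<noteq> 0"
  obtains k e where "k \<noteq> 0" "e \<noteq> 0" "\<And>j. poly (coeff f j) a' = k * e ^ j * poly (coeff f j) a"
proof -
  obtain w where w: "\<And>i j. coeff (coeff f j) i \<noteq> 0 \<Longrightarrow> w = \<alpha> * int i + \<beta> * int j"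
    using assms(1) unfolding quasi_homogeneous_def by blast
  \<comment> \<open>With t = exp s this makes t^\<alpha> = a'/a. Exponentials supply the \<alpha>-th
    root and cover weights of either sign.\<close>
  define s where "s = Ln (a' / a) / of_int \<alpha>"
  have a': "a' = a * exp (of_int \<alpha> * s)"
    using assms by (simp add: s_def)
  have summand: "coeff (coeff f j) i * a' ^ i =
      exp (of_int w * s) * exp (- of_int \<beta> * s) ^ j * (coeff (coeff f j) i * a ^ i)" for i j
  proof (cases "coeff (coeff f j) i = 0")
    case False
    have "exp (of_int \<alpha> * s) ^ i = exp (of_int (\<alpha> * int i) * s)"
      by (simp add: exp_of_nat_mult [symmetric] algebra_simps)
    also have "\<alpha> * int i = w - \<beta> * int j"
      using w [OF False] by simp
    also have "exp (of_int (w - \<beta> * int j) * s) = exp (of_int w * s) * exp (- of_int \<beta> * s) ^ j"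
      by (simp add: exp_of_nat_mult [symmetric] exp_add [symmetric] algebra_simps)
    finally show ?thesis
      by (simp add: a' power_mult_distrib)
  qed simp
  have "poly (coeff f j) a' = exp (of_int w * s) * exp (- of_int \<beta> * s) ^ j * poly (coeff f j) a" for j
    unfolding poly_altdef summand sum_distrib_left ..
  then show ?thesis
    using that [of "exp (of_int w * s)" "exp (- of_int \<beta> * s)"] by simp
qed

lemma quasi_homogeneous_imp_unramified:
  assumes "reduced f" "coeff f 0 \<noteq> 0" "quasi_homogeneous f \<alpha> \<beta>" "\<alpha> \<noteq> 0"
  shows "unramified f"
  unfolding unramified_def
proof (intro allI impI conjI)
  fix a :: complex assume "a \<noteq> 0"
  have "f \<noteq> 0"
    using assms(2) by auto
  have nonroot: "poly (coeff f j) a \<noteq> 0" if nz: "coeff f j \<noteq> 0" for j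
  proof -
    obtain b where b: "b \<noteq> 0" "poly (coeff f j) b \<noteq> 0"
      using ex_nonzero_nonroot [OF nz] .
    obtain k e where "poly (coeff f j) b = k * e ^ j * poly (coeff f j) a"
      using quasi_homogeneous_rescale [OF assms(3,4) \<open>a \<noteq> 0\<close> b(1)] by metis
    with b show ?thesis by auto
  qed
  then show "poly (coeff f 0) a \<noteq> 0" "poly (lead_coeff f) a \<noteq> 0"
    using assms(2) \<open>f \<noteq> 0\<close> by simp_all
  obtain b where b: "b \<noteq> 0" "rsquarefree (specialize_x f b)"
    using reduced_ex_rsquarefree [OF assms(1) \<open>f \<noteq> 0\<close>] .
  obtain k e where ke: "k \<noteq> 0" "e \<noteq> 0" "\<And>j. poly (coeff f j) a = k * e ^ j * poly (coeff f j) b"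
    using quasi_homogeneous_rescale [OF assms(3,4) b(1) \<open>a \<noteq> 0\<close>] by metis
  \<comment> \<open>The fibre polynomial over a is k f(b, e y), so the invertible substitution of e
    y for y carries square-freeness over.\<close>
  then have eq: "specialize_x f a = smult k (pcompose (specialize_x f b) [:0, e:])"
    by (simp add: poly_eq_iff coeff_pcompose_linear)
  show "rsquarefree (specialize_x f a)"
    using b(2) ke(1,2)
    by (auto simp: eq rsquarefree_roots pderiv_smult pderiv_pcompose poly_pcompose pderiv_pCons
        simp del: poly_specialize_x)
qed

section \<open>The discriminant\<close>

lemma poly_pderiv_prod_at_root:
  fixes b :: "nat \<Rightarrow> complex"
  assumes "j < n"
  shows "poly (pderiv (\<Prod>i<n. [:- b i, 1:])) (b j) = (\<Prod>i\<in>{..<n} - {j}. b j - b i)"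
proof -
  have "(\<Prod>i<n. [:- b i, 1:]) = [:- b j, 1:] * (\<Prod>i\<in>{..<n} - {j}. [:- b i, 1:])"
    using assms by (subst prod.remove [of _ j]) auto
  then show ?thesis
    by (simp only: pderiv_mult) (simp add: pderiv_pCons poly_prod)
qed

text \<open>Each unordered pair contributes (b_i - b_j)(b_j - b_i), the negative of a square, and
  the number of pairs is the sum of all j < n.\<close>

lemma prod_differences:
  fixes b :: "nat \<Rightarrow> complex"
  shows "(\<Prod>j<n. \<Prod>i\<in>{..<n} - {j}. b j - b i) =
    (- 1) ^ (\<Sum>j<n. j) * (\<Prod>j<n. \<Prod>i<j. (b i - b j) ^ 2)"
proof (induction n)
  case (Suc n)
  have "(\<Prod>i\<in>{..<Suc n} - {j}. b j - b i) = (b j - b n) * (\<Prod>i\<in>{..<n} - {j}. b j - b i)"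
    if "j < n" for j
  proof -
    have "{..<Suc n} - {j} = insert n ({..<n} - {j})"
      using that by auto
    then show ?thesis by simp
  qed
  moreover have "{..<Suc n} - {n} = {..<n}"
    by auto
  ultimately have "(\<Prod>j<Suc n. \<Prod>i\<in>{..<Suc n} - {j}. b j - b i) =
      (\<Prod>j<n. (b j - b n) * (\<Prod>i\<in>{..<n} - {j}. b j - b i)) * (\<Prod>i<n. b n - b i)"
    by simp
  also have "\<dots> = (\<Prod>i<n. (b i - b n) * (b n - b i)) * (\<Prod>j<n. \<Prod>i\<in>{..<n} - {j}. b j - b i)"
    by (simp add: prod.distrib)
  also have "(\<Prod>i<n. (b i - b n) * (b n - b i)) = (\<Prod>i<n. (- 1) * (b i - b n) ^ 2)"
    by (intro prod.cong) (auto simp: power2_eq_square algebra_simps)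
  also have "\<dots> = (- 1) ^ n * (\<Prod>i<n. (b i - b n) ^ 2)"
    unfolding prod.distrib by simp
  finally show ?case
    by (simp add: Suc.IH power_add)
qed simp

lemma prod_pderiv_at_roots:
  fixes b :: "nat \<Rightarrow> complex"
  shows "(\<Prod>j<n. poly (pderiv (smult c (\<Prod>i<n. [:- b i, 1:]))) (b j)) =
    c ^ n * ((- 1) ^ (\<Sum>j<n. j) * (\<Prod>j<n. \<Prod>i<j. (b i - b j) ^ 2))"
  by (simp add: pderiv_smult poly_pderiv_prod_at_root prod.distrib prod_differences)

text \<open>The rows are the remainders modulo \<open>f\<close> of \<open>pderiv f\<close> times the Horner quotients of \<open>f\<close>.
  This is the Bezout matrix of \<open>f\<close> and \<open>pderiv f\<close>, with the leading coefficient of \<open>f\<close> cancelled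
  in the first row.\<close>

definition disc_row :: "'a::idom poly \<Rightarrow> nat \<Rightarrow> 'a poly" where
  "disc_row f k = (if k = 0 then pderiv f
     else poly_shift (degree f - k) f * pderiv f - f * poly_shift (degree f - k) (pderiv f))"

definition disc_mat :: "'a::idom poly \<Rightarrow> 'a mat" where
  "disc_mat f = mat (degree f) (degree f) (\<lambda>(k, i). coeff (disc_row f k) i)"

section \<open>Degrees and divisibility in the Bezout matrix\<close>

lemma poly_shift_cutoff: "monom 1 m * poly_shift m p + poly_cutoff m p = (p :: 'a::comm_semiring_1 poly)"
  by (auto simp: poly_eq_iff coeff_monom_mult coeff_poly_shift coeff_poly_cutoff)

lemma degree_poly_shift: "degree (poly_shift m p) \<le> degree p - m"
  by (intro degree_le) (auto simp: coeff_poly_shift coeff_eq_0)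

lemma degree_poly_cutoff: "degree (poly_cutoff m p) \<le> m - 1"
  by (intro degree_le) (auto simp: coeff_poly_cutoff)

lemma coeff_mult_degree_le:
  fixes p q :: "'a::comm_semiring_0 poly"
  assumes "degree p \<le> a" "degree q \<le> b"
  shows "coeff (p * q) (a + b) = coeff p a * coeff q b"
proof -
  have "coeff p i * coeff q (a + b - i) = 0" if "i \<le> a + b" "i \<noteq> a" for i
    using assms that by (cases "i < a") (auto simp: coeff_eq_0)
  then show ?thesis
    unfolding coeff_mult by (subst sum.remove [of _ a]) (auto intro!: sum.neutral)
qed

text \<open>After splitting both factors at y^m, the terms carrying y^m cancel; each remaining
  product pairs a high part with a low part, which bounds its degree.\<close>

lemma disc_row_conv_cutoff:
  fixes f :: "'a::idom poly"
  assumes "k > 0"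
  shows "disc_row f k = poly_shift (degree f - k) f * poly_cutoff (degree f - k) (pderiv f)
    - poly_cutoff (degree f - k) f * poly_shift (degree f - k) (pderiv f)"
proof -
  let ?m = "degree f - k"
  have "disc_row f k = poly_shift ?m f * (monom 1 ?m * poly_shift ?m (pderiv f) + poly_cutoff ?m (pderiv f))
      - (monom 1 ?m * poly_shift ?m f + poly_cutoff ?m f) * poly_shift ?m (pderiv f)"
    using assms by (simp add: disc_row_def poly_shift_cutoff)
  then show ?thesis
    by (simp add: algebra_simps)
qed

lemma degree_pderiv_less: "degree f > 0 \<Longrightarrow> degree (pderiv f) < degree (f :: 'a::idom poly)"
  by (intro degree_lessI) (auto simp: coeff_pderiv coeff_eq_0)

lemma degree_disc_row:
  fixes f :: "'a::idom poly"
  assumes "k < degree f"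
  shows "degree (disc_row f k) < degree f"
proof (cases "k = 0")
  case True
  then show ?thesis
    using assms by (simp add: disc_row_def degree_pderiv_less)
next
  case False
  let ?m = "degree f - k"
  have "degree (poly_shift ?m f * poly_cutoff ?m (pderiv f)) \<le> (degree f - ?m) + (?m - 1)"
    by (intro order.trans [OF degree_mult_le] add_mono degree_poly_shift degree_poly_cutoff)
  moreover have "degree (poly_cutoff ?m f * poly_shift ?m (pderiv f)) \<le> (?m - 1) + (degree (pderiv f) - ?m)"
    by (intro order.trans [OF degree_mult_le] add_mono degree_poly_shift degree_poly_cutoff)
  ultimately show ?thesis
    using assms False degree_pderiv_less [of f]
    by (simp add: disc_row_conv_cutoff) (intro degree_diff_less; simp)
qed

text \<open>For k > 0 the second product has degree below n - 1, and the top coefficient of the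
  first contains that of f. For k = 0 the entry is n times the leading coefficient.\<close>

lemma lead_coeff_dvd_coeff_disc_row:
  fixes f :: "'a::idom poly"
  assumes "k < degree f"
  shows "lead_coeff f dvd coeff (disc_row f k) (degree f - 1)"
proof (cases "k = 0")
  case True
  then show ?thesis
    using assms by (simp add: disc_row_def coeff_pderiv)
next
  case False
  let ?m = "degree f - k"
  have eq: "degree f - 1 = k + (?m - 1)" and "degree f - ?m = k"
    using assms False by auto
  have "coeff (poly_shift ?m f * poly_cutoff ?m (pderiv f)) (degree f - 1) =
      coeff (poly_shift ?m f) k * coeff (poly_cutoff ?m (pderiv f)) (?m - 1)"
    using degree_poly_shift [of ?m f] \<open>degree f - ?m = k\<close> degree_poly_cutoff [of ?m "pderiv f"]
    by (subst eq, intro coeff_mult_degree_le) auto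
  moreover have "coeff (poly_shift ?m f) k = lead_coeff f"
    using assms by (simp add: coeff_poly_shift)
  moreover have "degree (poly_cutoff ?m f * poly_shift ?m (pderiv f)) \<le> (?m - 1) + (degree (pderiv f) - ?m)"
    by (intro order.trans [OF degree_mult_le] add_mono degree_poly_shift degree_poly_cutoff)
  then have "coeff (poly_cutoff ?m f * poly_shift ?m (pderiv f)) (degree f - 1) = 0"
    using assms False degree_pderiv_less [of f] by (intro coeff_eq_0) auto
  ultimately show ?thesis
    using False by (simp add: disc_row_conv_cutoff)
qed

text \<open>Expand along the last column, whose entries are all divisible. The quotient will be the
  discriminant up to sign.\<close>

lemma lead_coeff_dvd_det_disc_mat:
  fixes f :: "'a::idom poly"
  assumes "degree f > 0"
  shows "lead_coeff f dvd det (disc_mat f)"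
proof -
  have "det (disc_mat f) = (\<Sum>k<degree f. disc_mat f $$ (k, degree f - 1) *
      cofactor (disc_mat f) k (degree f - 1))"
    using assms by (intro laplace_expansion_column) (auto simp: disc_mat_def)
  also have "lead_coeff f dvd \<dots>"
    using assms lead_coeff_dvd_coeff_disc_row [of _ f]
    by (intro dvd_sum dvd_mult2) (auto simp: disc_mat_def)
  finally show ?thesis .
qed

section \<open>The Bezout determinant in terms of the roots\<close>

lemma det_vandermonde_nonzero:
  fixes b :: "nat \<Rightarrow> complex"
  assumes "inj_on b {..<n}"
  shows "det (mat n n (\<lambda>(i, j). b j ^ i)) \<noteq> 0"
proof
  let ?V = "mat n n (\<lambda>(i, j). b j ^ i)"
  assume "det ?V = 0"
  then have "det (transpose_mat ?V) = 0"
    by (subst det_transpose [of _ n]) auto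
  then obtain v where v: "v \<in> carrier_vec n" "v \<noteq> 0\<^sub>v n" "transpose_mat ?V *\<^sub>v v = 0\<^sub>v n"
    using det_0_iff_vec_prod_zero [of "transpose_mat ?V" n] by auto
  \<comment> \<open>A kernel vector of the transpose is the coefficient vector of a nonzero
    polynomial of degree below n with n distinct roots.\<close>
  define q where "q = (\<Sum>i<n. monom (v $ i) i)"
  have coeff_q: "coeff q i = (if i < n then v $ i else 0)" for i
    by (auto simp: q_def coeff_sum)
  have "poly q (b j) = 0" if "j < n" for j
  proof -
    have "0 = (transpose_mat ?V *\<^sub>v v) $ j"
      using that v(3) by simp
    also have "\<dots> = poly q (b j)"
      using that v(1) by (simp add: q_def poly_sum poly_monom scalar_prod_def mult.commute atLeast0LessThan)
    finally show ?thesis ..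
  qed
  then have "b ` {..<n} \<subseteq> {x. poly q x = 0}"
    by auto
  moreover have "card (b ` {..<n}) = n"
    using assms by (simp add: card_image)
  moreover have "q \<noteq> 0"
  proof
    assume "q = 0"
    then have "v $ i = 0" if "i < n" for i
      using coeff_q [of i] that by simp
    with v(1,2) show False by (auto intro!: eq_vecI)
  qed
  moreover have "degree q < n"
    using \<open>q \<noteq> 0\<close> coeff_q by (metis leading_coeff_0_iff)
  ultimately show False
    using card_poly_roots_bound [of q] card_mono [of "{x. poly q x = 0}" "b ` {..<n}"] poly_roots_finite [of q]
    by auto
qed

text \<open>At a root of the fibre, row k takes the value of \<open>H k\<close> times the
  derivative. So the evaluated matrix times the Vandermonde matrix V is T V D with T triangular and
  D diagonal, and det V cancels. T contributes n - 1 leading coefficients and D contributes n, one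
  more than the discriminant has.\<close>

lemma det_disc_mat_at:
  fixes f :: "complex poly poly"
  defines "n \<equiv> degree f"
  assumes "n > 0" and lc: "poly (lead_coeff f) a \<noteq> 0"
    and split: "specialize_x f a = smult (poly (lead_coeff f) a) (\<Prod>i<n. [:- b i, 1:])"
  shows "poly (det (disc_mat f)) a = poly (lead_coeff f) a ^ (2 * n - 1) *
    ((- 1) ^ (\<Sum>j<n. j) * (\<Prod>j<n. \<Prod>i<j. (b i - b j) ^ 2))"
proof -
  interpret ev: comm_ring_hom "\<lambda>p. poly p a"
    by unfold_locales auto
  define N where "N = map_mat (\<lambda>p. poly p a) (disc_mat f)"
  have N: "N \<in> carrier_mat n n"
    by (simp add: N_def disc_mat_def n_def)
  have det_N: "det N = poly (det (disc_mat f)) a"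
    by (simp add: N_def)
  define d where "d t = poly (pderiv (specialize_x f a)) t" for t
  \<comment> \<open>The Horner quotient for k = 0 would be the leading coefficient; it is 1 here
    because row 0 has that factor cancelled.\<close>
  define H where "H k = (if k = 0 then 1 else specialize_x (poly_shift (n - k) f) a)" for k
  have root: "poly (poly f [:b j:]) a = 0" if "j < n" for j
  proof -
    have "poly (specialize_x f a) (b j) = 0"
      unfolding split using that by (auto simp: poly_prod)
    then show ?thesis by simp
  qed
  have N_row: "(\<Sum>i<n. N $$ (k, i) * b j ^ i) = poly (H k) (b j) * d (b j)" if "k < n" "j < n" for k j
  proof -
    have deg: "degree (specialize_x (disc_row f k) a) < n"
      using degree_disc_row [of k f] that(1)
      by (intro degree_lessI) (auto simp: coeff_eq_0 n_def)
    have "(\<Sum>i<n. N $$ (k, i) * b j ^ i) = poly (specialize_x (disc_row f k) a) (b j)"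
      using that(1) poly_eq_sum_le [of "specialize_x (disc_row f k) a" "n - 1" "b j"] deg
      by (simp add: N_def disc_mat_def n_def lessThan_Suc_atMost [symmetric] del: poly_specialize_x)
    also have "\<dots> = poly (H k) (b j) * d (b j)"
      using root [OF that(2)] by (simp add: disc_row_def H_def d_def pderiv_specialize_x n_def)
    finally show ?thesis .
  qed
  show ?thesis
  proof (cases "inj_on b {..<n}")
    \<comment> \<open>With a repeated root both sides vanish: the derivative is zero there, and the
      vector of powers of the root, whose entry 0 is 1, lies in the kernel of
      \<open>N\<close>.\<close>
    case False
    then obtain i j where ij: "i < j" "j < n" "b i = b j"
      by (metis inj_onI lessThan_iff linorder_neqE_nat)
    have "d (b j) = 0"
      using ij poly_pderiv_prod_at_root [of j n b]
      by (auto simp: d_def split pderiv_smult intro!: bexI [of _ i])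
    define v where "v = vec n (\<lambda>i. b j ^ i)"
    have "N *\<^sub>v v = 0\<^sub>v n"
      using N N_row ij(2) \<open>d (b j) = 0\<close>
      by (intro eq_vecI) (auto simp: v_def scalar_prod_def atLeast0LessThan)
    moreover have "v \<noteq> 0\<^sub>v n"
    proof
      assume "v = 0\<^sub>v n"
      then have "v $ 0 = 0"
        using \<open>n > 0\<close> by simp
      then show False
        using \<open>n > 0\<close> by (simp add: v_def)
    qed
    moreover have "v \<in> carrier_vec n"
      by (simp add: v_def)
    ultimately have "det N = 0"
      using det_0_iff_vec_prod_zero [OF N] by blast
    moreover have "(\<Prod>i<j. (b i - b j) ^ 2) = 0"
      using ij by (intro prod_zero) auto
    then have "(\<Prod>j<n. \<Prod>i<j. (b i - b j) ^ 2) = 0"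
      using ij by (intro prod_zero) auto
    ultimately show ?thesis
      by (simp add: det_N)
  next
    case True
    define V where "V = mat n n (\<lambda>(i, j). b j ^ i)"
    define T where "T = mat n n (\<lambda>(k, i). coeff (H k) i)"
    define D where "D = mat n n (\<lambda>(i, j). if i = j then d (b j) else 0)"
    have carrier: "V \<in> carrier_mat n n" "T \<in> carrier_mat n n" "D \<in> carrier_mat n n"
      by (simp_all add: V_def T_def D_def)
    have H_above: "coeff (H k) i = 0" if "k < n" "k < i" for k i
      using that by (auto simp: H_def coeff_poly_shift coeff_eq_0 n_def)
    have H_diag: "coeff (H k) k = (if k = 0 then 1 else poly (lead_coeff f) a)" if "k < n" for k
      using that by (auto simp: H_def coeff_poly_shift n_def)
    define M where "M = T * V"
    have M: "M \<in> carrier_mat n n"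
      using carrier by (simp add: M_def)
    have M_entry: "M $$ (k, j) = poly (H k) (b j)" if "k < n" "j < n" for k j
    proof -
      have "degree (H k) \<le> n - 1"
        using that(1) H_above by (intro degree_le) auto
      then show ?thesis
        using that poly_eq_sum_le [of "H k" "n - 1" "b j"]
        by (simp add: M_def T_def V_def scalar_prod_def atLeast0LessThan lessThan_Suc_atMost [symmetric])
    qed
    have "N * V = M * D"
    proof (rule eq_matI)
      fix k j assume "k < dim_row (M * D)" "j < dim_col (M * D)"
      then have "k < n" "j < n"
        using carrier M by auto
      then have "(M * D) $$ (k, j) = (\<Sum>i<n. if i = j then M $$ (k, i) * d (b j) else 0)"
        using M by (simp add: D_def scalar_prod_def atLeast0LessThan if_distrib cong: if_cong)
      also have "\<dots> = poly (H k) (b j) * d (b j)"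
        using M_entry \<open>k < n\<close> \<open>j < n\<close> by simp
      also have "\<dots> = (N * V) $$ (k, j)"
        using N_row [of k j] N \<open>k < n\<close> \<open>j < n\<close>
        by (simp add: V_def scalar_prod_def atLeast0LessThan)
      finally show "(N * V) $$ (k, j) = (M * D) $$ (k, j)" ..
    qed (use N M carrier in auto)
    then have "det N * det V = det T * det V * det D"
      using det_mult [OF N carrier(1)] det_mult [OF M carrier(3)] det_mult [OF carrier(2,1)]
      by (simp add: M_def)
    moreover have "det V \<noteq> 0"
      unfolding V_def by (rule det_vandermonde_nonzero [OF True])
    ultimately have "det N = det T * det D"
      by simp
    also have "det D = (\<Prod>j<n. d (b j))"
      using carrier by (subst det_lower_triangular [of n])
        (auto simp: D_def prod_list_diag_prod atLeast0LessThan)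
    also have "\<dots> = poly (lead_coeff f) a ^ n *
        ((- 1) ^ (\<Sum>j<n. j) * (\<Prod>j<n. \<Prod>i<j. (b i - b j) ^ 2))"
      unfolding d_def split by (rule prod_pderiv_at_roots)
    also have "det T = (\<Prod>k<n. T $$ (k, k))"
      using carrier H_above by (subst det_lower_triangular [of n])
        (auto simp: T_def prod_list_diag_prod atLeast0LessThan)
    also have "\<dots> = (\<Prod>k<n. if k = 0 then 1 else poly (lead_coeff f) a)"
      by (intro prod.cong) (auto simp: T_def H_diag)
    also have "\<dots> = poly (lead_coeff f) a ^ (n - 1)"
      using \<open>n > 0\<close> by (subst prod.remove [of _ 0]) auto
    finally show ?thesis
      using \<open>n > 0\<close>
      by (simp add: det_N mult.assoc [symmetric] power_add [symmetric] mult_2)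
  qed
qed

section \<open>Existence, uniqueness and zeros of the discriminant\<close>

lemma is_discriminantD:
  assumes "is_discriminant f D" "poly (lead_coeff f) a \<noteq> 0"
    and "specialize_x f a = smult (poly (lead_coeff f) a) (\<Prod>i<degree f. [:- b i, 1:])"
  shows "poly D a = poly (lead_coeff f) a ^ (2 * degree f - 2) *
    (\<Prod>j<degree f. \<Prod>i<j. (b i - b j) ^ 2)"
proof -
  let ?bs = "map b [0..<degree f]"
  have "(\<Prod>b\<leftarrow>?bs. [:- b, 1:]) = (\<Prod>i<degree f. [:- b i, 1:])"
    by (simp add: prod.list_conv_set_nth atLeast0LessThan)
  then have "specialize_x f a = smult (poly (lead_coeff f) a) (\<Prod>b\<leftarrow>?bs. [:- b, 1:])"
    using assms(3) by (simp only:)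
  then have "poly D a = poly (lead_coeff f) a ^ (2 * degree f - 2) *
      (\<Prod>j<length ?bs. \<Prod>i<j. (?bs ! i - ?bs ! j) ^ 2)"
    using assms(1,2) unfolding is_discriminant_def by blast
  also have "(\<Prod>j<length ?bs. \<Prod>i<j. (?bs ! i - ?bs ! j) ^ 2) =
      (\<Prod>j<degree f. \<Prod>i<j. (b i - b j) ^ 2)"
    by (intro prod.cong) auto
  finally show ?thesis .
qed

lemma specialize_x_split:
  assumes "poly (lead_coeff f) a \<noteq> 0"
  obtains b where "specialize_x f a = smult (poly (lead_coeff f) a) (\<Prod>i<degree f. [:- b i, 1:])"
proof -
  let ?p = "specialize_x f a"
  obtain b where "smult (lead_coeff ?p) (\<Prod>i<degree ?p. [:- b i, 1:]) = ?p"
    by (rule complex_poly_decompose')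
  then show ?thesis
    using that [of b] by (simp add: degree_specialize_x [OF assms])
qed

text \<open>Dividing the Bezout determinant by the leading coefficient and correcting the sign gives
  existence. This justifies the \<open>THE\<close> in \<open>Disc_y\<close>.\<close>

lemma ex1_discriminant:
  assumes "degree f > 0"
  shows "\<exists>!D. is_discriminant f D"
proof (rule ex_ex1I)
  define n where "n = degree f"
  obtain D0 where D0: "det (disc_mat f) = lead_coeff f * D0"
    using lead_coeff_dvd_det_disc_mat [OF assms] by (elim dvdE)
  have "is_discriminant f (smult ((- 1) ^ (\<Sum>j<n. j)) D0)"
    unfolding is_discriminant_def
  proof (intro allI impI)
    fix a bs
    assume lc: "poly (lead_coeff f) a \<noteq> 0"
      and split: "specialize_x f a = smult (poly (lead_coeff f) a) (\<Prod>b\<leftarrow>bs. [:- b, 1:])"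
    have list: "(\<Prod>b\<leftarrow>bs. [:- b, 1:]) = (\<Prod>i<length bs. [:- (bs ! i), 1:])"
      by (simp add: prod.list_conv_set_nth atLeast0LessThan)
    have "n = degree (specialize_x f a)"
      using degree_specialize_x [OF lc] by (simp add: n_def)
    also have "\<dots> = length bs"
      unfolding split list using lc by (simp add: degree_prod_sum_eq)
    finally have len: "length bs = n" ..
    let ?D = "\<Prod>j<n. \<Prod>i<j. (bs ! i - bs ! j) ^ 2"
    have "poly (lead_coeff f) a * poly D0 a = poly (lead_coeff f) a ^ (2 * n - 1) * ((- 1) ^ (\<Sum>j<n. j) * ?D)"
      using det_disc_mat_at [OF _ lc, of "\<lambda>i. bs ! i"] assms split list len
      by (simp add: D0 n_def)
    also have "2 * n - 1 = Suc (2 * n - 2)"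
      using assms by (simp add: n_def)
    finally have "poly D0 a = poly (lead_coeff f) a ^ (2 * n - 2) * ((- 1) ^ (\<Sum>j<n. j) * ?D)"
      using lc by simp
    then show "poly (smult ((- 1) ^ (\<Sum>j<n. j)) D0) a = poly (lead_coeff f) a ^ (2 * degree f - 2) *
        (\<Prod>j<length bs. \<Prod>i<j. (bs ! i - bs ! j) ^ 2)"
      by (simp add: len n_def flip: power_mult_distrib)
  qed
  then show "\<exists>D. is_discriminant f D" ..
next
  fix D D' assume D: "is_discriminant f D" "is_discriminant f D'"
  \<comment> \<open>The factor \<open>lead_coeff f\<close> covers the points that the product
    formula leaves out.\<close>
  have "poly ((D - D') * lead_coeff f) a = 0" for a
  proof (cases "poly (lead_coeff f) a = 0")
    case False
    then obtain b where
      "specialize_x f a = smult (poly (lead_coeff f) a) (\<Prod>i<degree f. [:- b i, 1:])"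
      by (rule specialize_x_split)
    then show ?thesis
      using D [THEN is_discriminantD, OF False] by simp
  qed simp
  then have "(D - D') * lead_coeff f = 0"
    using poly_all_0_iff_0 by blast
  then show "D = D'"
    using assms by auto
qed

text \<open>The product of the derivative values at all roots vanishes exactly if some root is
  multiple. Up to sign and a power of the leading coefficient it is the product of squared
  differences.\<close>

lemma poly_Disc_y_nonzero_iff:
  assumes "poly (lead_coeff f) a \<noteq> 0"
  shows "poly (Disc_y f) a \<noteq> 0 \<longleftrightarrow> rsquarefree (specialize_x f a)"
proof -
  define n where "n = degree f"
  let ?p = "specialize_x f a"
  obtain b where b: "?p = smult (poly (lead_coeff f) a) (\<Prod>i<n. [:- b i, 1:])"
    unfolding n_def using assms by (rule specialize_x_split)
  have "poly ?p t = 0 \<longleftrightarrow> (\<exists>j<n. t = b j)" for t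
    unfolding b using assms by (auto simp: poly_prod)
  then have "rsquarefree ?p \<longleftrightarrow> (\<Prod>j<n. poly (pderiv ?p) (b j)) \<noteq> 0"
    unfolding rsquarefree_roots by (auto simp del: poly_specialize_x)
  also have "\<dots> \<longleftrightarrow> (\<Prod>j<n. \<Prod>i<j. (b i - b j) ^ 2) \<noteq> 0"
    unfolding b prod_pderiv_at_roots using assms by simp
  also have "\<dots> \<longleftrightarrow> poly (Disc_y f) a \<noteq> 0"
  proof (cases "n \<le> 1")
    \<comment> \<open>There are no pairs of roots, so the empty product 1 agrees with the convention
      for degree at most 1.\<close>
    case True
    then have "n = 0 \<or> n = 1"
      by auto
    then have "(\<Prod>j<n. \<Prod>i<j. (b i - b j) ^ 2) = 1"
      by auto
    with True show ?thesis
      by (simp add: Disc_y_def n_def)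
  next
    case False
    then have "is_discriminant f (Disc_y f)"
      using theI' [OF ex1_discriminant [of f]] by (simp add: Disc_y_def n_def)
    from is_discriminantD [OF this assms] b show ?thesis
      using assms by (simp add: n_def)
  qed
  finally show ?thesis ..
qed

lemma monomials_iff_unramified:
  assumes "coeff f 0 \<noteq> 0"
  shows "nonzero_monomial (coeff f 0) \<and> nonzero_monomial (lead_coeff f) \<and> nonzero_monomial (Disc_y f)
    \<longleftrightarrow> unramified f"
proof -
  have "f \<noteq> 0"
    using assms by auto
  have "Disc_y f \<noteq> 0" if "unramified f"
  proof -
    have "poly (Disc_y f) 1 \<noteq> 0"
      using that poly_Disc_y_nonzero_iff [of f 1] unfolding unramified_def by simp
    then show ?thesis by auto
  qed
  moreover have "lead_coeff f \<noteq> 0"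
    using \<open>f \<noteq> 0\<close> by simp
  ultimately show ?thesis
    unfolding nonzero_monomial_iff unramified_def using assms poly_Disc_y_nonzero_iff [of f] by blast
qed

section \<open>Global root functions\<close>

text \<open>If all roots had distance at least r from y, the factorization would give the reverse
  inequality. This serves as a quantitative continuity of roots.\<close>

lemma root_near:
  fixes p :: "complex poly"
  assumes "norm (poly p y) < norm (lead_coeff p) * r ^ degree p" and "r > 0"
  obtains b where "poly p b = 0" "dist y b < r"
proof -
  obtain root where root: "smult (lead_coeff p) (\<Prod>i<degree p. [:-root i, 1:]) = p"
    by (rule complex_poly_decompose')
  have ev: "poly p t = lead_coeff p * (\<Prod>i<degree p. t - root i)" for t
    by (subst root [symmetric]) (simp add: poly_prod)
  have "\<exists>i<degree p. dist y (root i) < r"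
  proof (rule ccontr)
    assume none: "\<not> ?thesis"
    have "r \<le> norm (y - root i)" if "i < degree p" for i
      using that none by (metis dist_norm not_less)
    then have "(\<Prod>i<degree p. r) \<le> (\<Prod>i<degree p. norm (y - root i))"
      by (intro prod_mono) (use assms(2) in \<open>auto simp: dist_norm not_less not_le\<close>)
    then have "norm (lead_coeff p) * r ^ degree p \<le> norm (poly p y)"
      unfolding ev norm_mult prod_norm [symmetric] by (simp add: mult_left_mono)
    with assms(1) show False by simp
  qed
  then obtain i where "i < degree p" "dist y (root i) < r" by blast
  then show ?thesis
    using that [of "root i"] by (auto simp: ev)
qed

lemma card_roots_rsquarefree:
  fixes p :: "complex poly"
  assumes "rsquarefree p"
  shows "card {b. poly p b = 0} = degree p"
proof -
  have "p \<noteq> 0" using assms by (simp add: rsquarefree_def)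
  then have "degree p = degree (\<Prod>z|poly p z = 0. [:-z, 1:])"
    using arg_cong [OF complex_poly_decompose_rsquarefree [OF assms], of degree] by simp
  also have "\<dots> = card {b. poly p b = 0}"
    by (subst degree_prod_sum_eq) auto
  finally show ?thesis ..
qed

lemma continuous_on_poly_family:
  fixes P :: "'a::topological_space \<Rightarrow> complex poly"
  assumes "\<And>i. continuous_on S (\<lambda>z. coeff (P z) i)" "\<And>z. degree (P z) = n"
    and "continuous_on S g"
  shows "continuous_on S (\<lambda>z. poly (P z) (g z))"
  unfolding poly_altdef assms(2) by (intro continuous_intros assms)

text \<open>Over a neighbourhood of x, each of n disjoint balls around the roots of
  \<open>P x\<close> holds exactly one root of \<open>P z\<close>; these are the n sheets.\<close>

lemma covering_space_roots:
  fixes P :: "complex \<Rightarrow> complex poly"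
  assumes cont: "\<And>i. continuous_on UNIV (\<lambda>z. coeff (P z) i)"
    and deg: "\<And>z. degree (P z) = n" and "n > 0" and sq: "\<And>z. rsquarefree (P z)"
  shows "covering_space {(z, y). poly (P z) y = 0} fst UNIV"
proof
  let ?E = "{(z, y). poly (P z) y = 0}"
  have nz: "coeff (P z) n \<noteq> 0" for z
    using sq [of z] deg [of z] by (auto simp: rsquarefree_def)
  show "continuous_on ?E fst"
    by (intro continuous_intros)
  have "\<exists>y. poly (P z) y = 0" for z
    using card_roots_rsquarefree [OF sq, of z] deg [of z] \<open>n > 0\<close>
    by (metis (mono_tags, lifting) Collect_empty_eq card.empty not_gr_zero)
  then show "fst ` ?E = UNIV"
    by (force simp: image_iff)
  fix x :: complex
  define R where "R = {b. poly (P x) b = 0}"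
  have "finite R" "card R = n"
    using card_roots_rsquarefree [OF sq, of x] deg [of x] \<open>n > 0\<close>
    by (auto simp: R_def card_gt_0_iff intro: card_ge_0_finite)
  obtain r where "r > 0" and r: "\<And>b c. b \<in> R \<Longrightarrow> c \<in> R \<Longrightarrow> b \<noteq> c \<Longrightarrow> 2 * r \<le> dist b c"
  proof -
    \<comment> \<open>The inserted 1 keeps the set nonempty when there is only one root; half the
      minimum makes the balls disjoint.\<close>
    let ?D = "insert 1 ((\<lambda>(b, c). dist b c) ` {bc \<in> R \<times> R. fst bc \<noteq> snd bc})"
    have fin: "finite ?D"
      using \<open>finite R\<close> by simp
    then have "Min ?D > 0"
      by (subst Min_gr_iff) auto
    moreover have "Min ?D \<le> dist b c" if "b \<in> R" "c \<in> R" "b \<noteq> c" for b c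
      by (rule Min_le [OF fin]) (use that in force)
    ultimately show ?thesis
      using that [of "Min ?D / 2"] by simp
  qed
  have disj: "b = c" if "b \<in> R" "c \<in> R" "dist b y < r" "dist c y < r" for b c y
    using r [of b c] that dist_triangle2 [of b c y] by fastforce
  \<comment> \<open>For e > 0, \<open>root_near\<close> gives a root of \<open>P z\<close> within e
    of y for each z in this open set, which contains all z whose fibre has y as a root.\<close>
  define N where "N y e = {z. norm (poly (P z) y) < norm (coeff (P z) n) * e ^ n}" for y e
  have N_open: "open (N y e)" for y e
    unfolding N_def
    by (intro open_Collect_less continuous_intros cont continuous_on_poly_family [where n = n] deg)
  have N_root: "\<exists>b. poly (P z) b = 0 \<and> dist y b < e" if "z \<in> N y e" "e > 0" for z y e
    using root_near [of "P z" y e] that by (auto simp: N_def deg)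
  have N_mem: "z \<in> N y e" if "poly (P z) y = 0" "e > 0" for z y e
    using that nz by (simp add: N_def)
  define T where "T = (\<Inter>b\<in>R. N b r)"
  have "open T"
    unfolding T_def using \<open>finite R\<close> N_open by blast
  have "x \<in> T"
    unfolding T_def using N_mem \<open>r > 0\<close> by (auto simp: R_def)
  define q where "q b z = (SOME y. poly (P z) y = 0 \<and> dist b y < r)" for b z
  have q: "poly (P z) (q b z) = 0" "dist b (q b z) < r" if "z \<in> T" "b \<in> R" for z b
  proof -
    have "\<exists>y. poly (P z) y = 0 \<and> dist b y < r"
      using N_root [of z b r] that \<open>r > 0\<close> by (auto simp: T_def)
    then show "poly (P z) (q b z) = 0" "dist b (q b z) < r"
      unfolding q_def by (metis (mono_tags, lifting) someI_ex)+
  qed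
  \<comment> \<open>The disjoint balls already account for n roots, and \<open>P z\<close> has no
    more.\<close>
  have roots: "{y. poly (P z) y = 0} = (\<lambda>b. q b z) ` R" if "z \<in> T" for z
  proof (rule card_subset_eq [symmetric])
    show "finite {y. poly (P z) y = 0}"
      using nz [of z] by (auto intro!: poly_roots_finite)
    show "(\<lambda>b. q b z) ` R \<subseteq> {y. poly (P z) y = 0}"
      using q that by auto
    have "inj_on (\<lambda>b. q b z) R"
      by (intro inj_onI) (metis disj q(2) that)
    then show "card ((\<lambda>b. q b z) ` R) = card {y. poly (P z) y = 0}"
      using card_roots_rsquarefree [OF sq, of z] deg [of z] \<open>card R = n\<close> by (simp add: card_image)
  qed
  have uniq: "y = q b z" if y: "z \<in> T" "b \<in> R" "poly (P z) y = 0" "dist b y < r" for z b y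
  proof -
    obtain c where "c \<in> R" "y = q c z"
      using roots [OF y(1)] y(3) by blast
    then show ?thesis
      using disj [of b c y] q(2) [of z c] y by auto
  qed
  define u where "u b = ?E \<inter> (T \<times> ball b r)" for b
  have q_cont: "continuous_on T (q b)" if "b \<in> R" for b
  proof (rule continuous_on_eq_continuous_at [THEN iffD2, OF \<open>open T\<close>], rule ballI)
    fix z assume "z \<in> T"
    show "isCont (q b) z"
      unfolding continuous_at_eps_delta
    proof (intro allI impI)
      fix e :: real assume "e > 0"
      \<comment> \<open>The second bound keeps a root within e' of \<open>q b z\<close> inside the
        ball around b, where it must be \<open>q b w\<close>.\<close>
      define e' where "e' = min e (r - dist b (q b z))"
      have "e' > 0"
        using \<open>e > 0\<close> q(2) [OF \<open>z \<in> T\<close> that] by (simp add: e'_def)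
      have "open (N (q b z) e' \<inter> T)" "z \<in> N (q b z) e' \<inter> T"
        using N_open \<open>open T\<close> N_mem q(1) [OF \<open>z \<in> T\<close> that] \<open>e' > 0\<close> \<open>z \<in> T\<close> by auto
      then obtain d where "d > 0" and d: "\<And>w. dist w z < d \<Longrightarrow> w \<in> N (q b z) e' \<inter> T"
        unfolding open_dist by blast
      have "dist (q b w) (q b z) < e" if w: "dist w z < d" for w
      proof -
        obtain y where y: "poly (P w) y = 0" "dist (q b z) y < e'"
          using N_root [of w "q b z" e'] d [OF w] \<open>e' > 0\<close> by auto
        then have "dist b y < r"
          using dist_triangle [of b y "q b z"] by (simp add: e'_def)
        then have "y = q b w"
          using uniq d [OF w] \<open>b \<in> R\<close> y by blast
        then show ?thesis
          using y by (simp add: e'_def dist_commute)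
      qed
      then show "\<exists>d>0. \<forall>w. dist w z < d \<longrightarrow> dist (q b w) (q b z) < e"
        using \<open>d > 0\<close> by blast
    qed
  qed
  show "\<exists>T. x \<in> T \<and> openin (top_of_set UNIV) T \<and>
          (\<exists>v. \<Union> v = ?E \<inter> fst -` T \<and> (\<forall>u\<in>v. openin (top_of_set ?E) u) \<and>
            pairwise disjnt v \<and> (\<forall>u\<in>v. \<exists>q. homeomorphism u T fst q))"
  proof (intro exI [of _ T] conjI exI [of _ "u ` R"] ballI)
    show "\<Union> (u ` R) = ?E \<inter> fst -` T"
    proof (intro equalityI subsetI)
      fix p assume p: "p \<in> ?E \<inter> fst -` T"
      obtain z y where "p = (z, y)" by (cases p)
      with p have "z \<in> T" "poly (P z) y = 0" by auto
      then obtain b where "b \<in> R" "y = q b z"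
        using roots by blast
      then show "p \<in> \<Union> (u ` R)"
        using q [of z b] \<open>z \<in> T\<close> \<open>p = (z, y)\<close> by (auto simp: u_def)
    qed (auto simp: u_def)
    show "pairwise disjnt (u ` R)"
      by (auto simp: pairwise_def disjnt_def u_def dest: disj)
  next
    fix a assume "a \<in> u ` R"
    then obtain b where b: "b \<in> R" "a = u b" by blast
    show "openin (top_of_set ?E) a"
      unfolding b u_def by (intro openin_open_Int open_Times \<open>open T\<close> open_ball)
    have "homeomorphism (u b) T fst (\<lambda>z. (z, q b z))"
    proof (rule homeomorphismI)
      show "continuous_on (u b) fst"
        by (intro continuous_intros)
      show "continuous_on T (\<lambda>z. (z, q b z))"
        by (intro continuous_intros q_cont b)
    qed (use b q uniq in \<open>auto simp: u_def\<close>)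
    then show "\<exists>q. homeomorphism a T fst q"
      using b by blast
  qed (use \<open>x \<in> T\<close> \<open>open T\<close> in auto)
qed

text \<open>The plane is simply connected, so the identity lifts to the covering through each of the
  n points over 0. The lifts never meet and hence exhaust every fibre.\<close>

lemma global_roots:
  fixes P :: "complex \<Rightarrow> complex poly"
  assumes cont: "\<And>i. continuous_on UNIV (\<lambda>z. coeff (P z) i)"
    and deg: "\<And>z. degree (P z) = n" and "n > 0" and sq: "\<And>z. rsquarefree (P z)"
  obtains g :: "nat \<Rightarrow> complex \<Rightarrow> complex"
    where "\<And>b. b < n \<Longrightarrow> continuous_on UNIV (g b)" "\<And>z. inj_on (\<lambda>b. g b z) {..<n}"
      "\<And>z. P z = smult (coeff (P z) n) (\<Prod>b<n. [:- g b z, 1:])"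
proof -
  let ?E = "{(z, y). poly (P z) y = 0}"
  have cov: "covering_space ?E fst UNIV"
    using covering_space_roots [OF assms] .
  have card: "card {b. poly (P z) b = 0} = n" and fin: "finite {b. poly (P z) b = 0}" for z
    using card_roots_rsquarefree [OF sq, of z] deg [of z] \<open>n > 0\<close>
    by (auto intro: card_ge_0_finite)
  obtain r where r: "bij_betw r {..<n} {b. poly (P 0) b = 0}"
    using ex_bij_betw_nat_finite [OF fin [of 0]] unfolding card atLeast0LessThan by blast
  have "\<exists>h. continuous_on UNIV h \<and> (\<forall>z. h z \<in> ?E) \<and> h 0 = (0, r b) \<and> (\<forall>z. fst (h z) = z)"
    if "b < n" for b
  proof -
    have "(0, r b) \<in> ?E"
      using bij_betwE [OF r] that by auto
    then obtain h where "continuous_on UNIV h" "h \<in> UNIV \<rightarrow> ?E" "h 0 = (0, r b)"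
        "\<And>z. z \<in> UNIV \<Longrightarrow> fst (h z) = z"
      using covering_space_lift_strong [OF cov, of "(0, r b)" 0 UNIV "\<lambda>z. z"]
      by (auto simp: convex_imp_simply_connected convex_imp_locally_path_connected)
    then show ?thesis
      unfolding Pi_iff by (intro exI [of _ h]) simp
  qed
  then obtain h where h: "\<And>b. b < n \<Longrightarrow> continuous_on UNIV (h b)" "\<And>b z. b < n \<Longrightarrow> h b z \<in> ?E"
      "\<And>b. b < n \<Longrightarrow> h b 0 = (0, r b)" "\<And>b z. b < n \<Longrightarrow> fst (h b z) = z"
    by metis
  define g where "g b z = snd (h b z)" for b z
  have inj: "inj_on (\<lambda>b. g b z) {..<n}" for z
  proof (rule inj_onI)
    fix b c assume "b \<in> {..<n}" "c \<in> {..<n}" "g b z = g c z"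
    then have bc: "b < n" "c < n" "h b z = h c z"
      using h(4) by (auto simp: g_def prod_eq_iff)
    \<comment> \<open>Lifts that meet at z agree everywhere, in particular over 0, where different
      lifts start at different roots.\<close>
    have "h b 0 = h c 0"
      by (rule covering_space_lift_unique [where f = "\<lambda>z. z" and T = UNIV and a = z, OF cov])
         (use h bc connected_UNIV in \<open>simp_all add: Pi_iff\<close>)
    then have "r b = r c"
      using h(3) bc by simp
    then show "b = c"
      using bij_betw_imp_inj_on [OF r] bc by (auto dest: inj_onD)
  qed
  have root: "poly (P z) (g b z) = 0" if "b < n" for b z
    using h(2,4) [OF that, of z] by (auto simp: g_def split_beta)
  have "P z = smult (coeff (P z) n) (\<Prod>b<n. [:- g b z, 1:])" for z
  proof -
    have "(\<lambda>b. g b z) ` {..<n} = {b. poly (P z) b = 0}"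
      by (rule card_subset_eq) (use fin card root inj in \<open>auto simp: card_image\<close>)
    then have "(\<Prod>b | poly (P z) b = 0. [:- b, 1:]) = (\<Prod>b<n. [:- g b z, 1:])"
      using prod.reindex [OF inj, of "\<lambda>b. [:- b, 1:]" z] by (simp add: o_def)
    with complex_poly_decompose_rsquarefree [OF sq, of z] show ?thesis
      by (simp add: deg)
  qed
  moreover have "continuous_on UNIV (g b)" if "b < n" for b
    unfolding g_def by (intro continuous_intros h that)
  ultimately show ?thesis
    using that [of g] inj by blast
qed

text \<open>Freezing y at \<open>g b a\<close> gives a holomorphic u with u(z) = (g_b(z) - g_b(a))
  v(z), where v is continuous and v(a) is nonzero as the roots are distinct. Dividing by v gives the
  limit of the difference quotient of \<open>g b\<close>.\<close>

lemma global_roots_holomorphic: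
  fixes P :: "complex \<Rightarrow> complex poly"
  assumes hol: "\<And>i. (\<lambda>z. coeff (P z) i) holomorphic_on UNIV"
    and deg: "\<And>z. degree (P z) = n" and "n > 0" and sq: "\<And>z. rsquarefree (P z)"
  obtains g :: "nat \<Rightarrow> complex \<Rightarrow> complex"
    where "\<And>b. b < n \<Longrightarrow> g b holomorphic_on UNIV" "\<And>z. inj_on (\<lambda>b. g b z) {..<n}"
      "\<And>z. P z = smult (coeff (P z) n) (\<Prod>b<n. [:- g b z, 1:])"
proof -
  have cont: "continuous_on UNIV (\<lambda>z. coeff (P z) i)" for i
    by (intro holomorphic_on_imp_continuous_on hol)
  obtain g where g: "\<And>b. b < n \<Longrightarrow> continuous_on UNIV (g b)" "\<And>z. inj_on (\<lambda>b. g b z) {..<n}"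
      "\<And>z. P z = smult (coeff (P z) n) (\<Prod>b<n. [:- g b z, 1:])"
    using global_roots [OF cont deg \<open>n > 0\<close> sq] by blast
  have nz: "coeff (P z) n \<noteq> 0" for z
    using sq [of z] deg [of z] by (auto simp: rsquarefree_def)
  have "g b field_differentiable at a" if "b < n" for a b
  proof -
    define u where "u z = poly (P z) (g b a)" for z
    define v where "v z = - (coeff (P z) n * (\<Prod>c\<in>{..<n} - {b}. g b a - g c z))" for z
    have uv: "u z = (g b z - g b a) * v z" for z
    proof -
      have "u z = coeff (P z) n * (\<Prod>c<n. g b a - g c z)"
        unfolding u_def by (subst g(3)) (simp add: poly_prod)
      also have "(\<Prod>c<n. g b a - g c z) = (g b a - g b z) * (\<Prod>c\<in>{..<n} - {b}. g b a - g c z)"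
        using that by (subst prod.remove [of _ b]) auto
      finally show ?thesis
        by (simp add: v_def algebra_simps)
    qed
    have "v a \<noteq> 0"
      using g(2) [of a] that nz by (auto simp: v_def inj_on_def)
    have "continuous_on UNIV v"
      unfolding v_def by (intro continuous_intros cont g(1)) auto
    then have v: "v \<midarrow>a\<rightarrow> v a"
      by (simp add: continuous_on_eq_continuous_at isCont_def)
    have "u holomorphic_on UNIV"
      unfolding u_def poly_altdef deg by (intro holomorphic_intros hol)
    then obtain u' where "(u has_field_derivative u') (at a)"
      by (auto simp: holomorphic_on_def field_differentiable_def)
    then have "((\<lambda>z. u z / (z - a)) \<longlongrightarrow> u') (at a)"
      using uv [of a] by (simp add: has_field_derivative_iff)
    then have "((\<lambda>z. u z / (z - a) / v z) \<longlongrightarrow> u' / v a) (at a)"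
      by (intro tendsto_divide v \<open>v a \<noteq> 0\<close>)
    moreover have "\<forall>\<^sub>F z in at a. u z / (z - a) / v z = (g b z - g b a) / (z - a)"
      using tendsto_imp_eventually_ne [OF v \<open>v a \<noteq> 0\<close>]
      by eventually_elim (simp add: uv)
    ultimately have "((\<lambda>z. (g b z - g b a) / (z - a)) \<longlongrightarrow> u' / v a) (at a)"
      by (rule Lim_transform_eventually)
    then show ?thesis
      unfolding field_differentiable_def has_field_derivative_iff by blast
  qed
  then show ?thesis
    using that [of g] g(2,3) by (simp add: holomorphic_on_def)
qed

section \<open>Reading off the weights\<close>

lemma prod_linear_scale:
  fixes c :: "nat \<Rightarrow> complex"
  assumes "G \<noteq> 0"
  shows "(\<Prod>b<n. [:- (c b * G), 1:]) = smult (G ^ n) (pcompose (\<Prod>b<n. [:- c b, 1:]) [:0, 1 / G:])"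
proof -
  have "(\<Prod>b<n. [:- (c b * G), 1:]) = (\<Prod>b<n. smult G (pcompose [:- c b, 1:] [:0, 1 / G:]))"
    using assms by (intro prod.cong) (auto simp: pcompose_pCons)
  then show ?thesis
    by (simp add: prod_smult pcompose_prod)
qed

lemma monomial_exponents_eq:
  fixes A B :: complex
  assumes "\<And>x. x \<noteq> 0 \<Longrightarrow> A * x ^ p = B * x ^ r" "A \<noteq> 0"
  shows "p = r"
proof -
  have "A = B"
    using assms(1) [of 1] by simp
  then have "(2 :: complex) ^ p = 2 ^ r"
    using assms(1) [of 2] assms(2) by simp
  then have "(of_nat (2 ^ p) :: complex) = of_nat (2 ^ r)"
    by simp
  then show ?thesis
    unfolding of_nat_eq_iff by simp
qed

text \<open>All roots are constant multiples of one root, and scaling y by it leaves a fixed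
  polynomial with coefficients q. \<open>G\<close> is the value of that root at a logarithm of x; it
  may depend on the branch, so it is only claimed to exist for each x.\<close>

lemma unramified_coeffs:
  assumes "unramified f" "degree f > 0"
  obtains q where "\<And>x. x \<noteq> 0 \<Longrightarrow> \<exists>G. G \<noteq> 0 \<and> (\<forall>j\<le>degree f.
    poly (coeff f j) x = poly (lead_coeff f) x * q j * G ^ (degree f - j))"
proof -
  define n where "n = degree f"
  have "n > 0"
    using assms by (simp add: n_def)
  define P where "P z = specialize_x f (exp z)" for z
  have coeff_P: "coeff (P z) j = poly (coeff f j) (exp z)" for z j
    by (simp add: P_def)
  have unr: "coeff (P z) 0 \<noteq> 0" "coeff (P z) n \<noteq> 0" "rsquarefree (P z)" for z
    using assms(1) exp_not_eq_zero [of z] unfolding unramified_def P_def n_def by simp_all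
  have deg: "degree (P z) = n" for z
    using unr(2) unfolding P_def n_def by (intro degree_specialize_x) simp
  have "(\<lambda>z. coeff (P z) j) holomorphic_on UNIV" for j
    unfolding coeff_P poly_altdef by (intro holomorphic_intros)
  then obtain g where g: "\<And>b. b < n \<Longrightarrow> g b holomorphic_on UNIV" "\<And>z. inj_on (\<lambda>b. g b z) {..<n}"
      "\<And>z. P z = smult (coeff (P z) n) (\<Prod>b<n. [:- g b z, 1:])"
    using global_roots_holomorphic [where P = P, OF _ deg \<open>n > 0\<close> unr(3)] by blast
  have g_nz: "g b z \<noteq> 0" if "b < n" for b z
  proof
    assume "g b z = 0"
    then have "poly (P z) 0 = 0"
      using arg_cong [OF g(3) [of z], of "\<lambda>p. poly p 0"] that by (auto simp: poly_prod)
    then show False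
      using unr(1) [of z] by (simp add: poly_0_coeff_0)
  qed
  have "\<exists>c. \<forall>z. g b z = c * g 0 z" if "b < n" for b
  proof (cases "b = 0")
    case False
    have "(\<lambda>z. g b z / g 0 z) holomorphic_on UNIV"
      using g_nz \<open>n > 0\<close> that by (intro holomorphic_intros g(1)) auto
    \<comment> \<open>The value 0 is omitted because the roots are nonzero, the value 1 because they
      are distinct.\<close>
    moreover have "g b z / g 0 z \<noteq> 0 \<and> g b z / g 0 z \<noteq> 1" for z
      using g_nz [of _ z] \<open>n > 0\<close> that False inj_onD [OF g(2) [of z], of b 0] by auto
    ultimately obtain c where "(\<lambda>z. g b z / g 0 z) = (\<lambda>_. c)"
      by (rule little_Picard_01)
    then have "g b z / g 0 z = c" for z
      by metis
    then show ?thesis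
      using g_nz [OF \<open>n > 0\<close>] by (auto simp: field_simps)
  qed (auto intro: exI [of _ 1])
  then obtain c where c: "\<And>b z. b < n \<Longrightarrow> g b z = c b * g 0 z"
    by metis
  define q where "q = coeff (\<Prod>b<n. [:- c b, 1:])"
  have "\<exists>G. G \<noteq> 0 \<and> (\<forall>j\<le>n. poly (coeff f j) x = poly (lead_coeff f) x * q j * G ^ (n - j))"
    if "x \<noteq> 0" for x
  proof -
    define z where "z = Ln x"
    have x: "x = exp z"
      using that by (simp add: z_def)
    define G where "G = g 0 z"
    have "G \<noteq> 0"
      using g_nz \<open>n > 0\<close> by (simp add: G_def)
    have gG: "g b z = c b * G" if "b < n" for b
      unfolding G_def using that by (rule c)
    define L where "L = poly (lead_coeff f) x"
    have "P z = smult L (\<Prod>b<n. [:- g b z, 1:])"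
      using g(3) [of z] unfolding coeff_P L_def x n_def .
    also have "(\<Prod>b<n. [:- g b z, 1:]) = (\<Prod>b<n. [:- (c b * G), 1:])"
      by (intro prod.cong refl) (simp add: gG)
    also have "\<dots> = smult (G ^ n) (pcompose (\<Prod>b<n. [:- c b, 1:]) [:0, 1 / G:])"
      using \<open>G \<noteq> 0\<close> by (rule prod_linear_scale)
    finally have P_coeff: "coeff (P z) j = L * (G ^ n * ((1 / G) ^ j * q j))" for j
      by (simp only: coeff_smult coeff_pcompose_linear q_def)
    have "poly (coeff f j) x = poly (lead_coeff f) x * q j * G ^ (n - j)" if "j \<le> n" for j
    proof -
      have "poly (coeff f j) x = L * (G ^ n * ((1 / G) ^ j * q j))"
        using P_coeff [of j] by (simp only: coeff_P x [symmetric])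
      also have "G ^ n * ((1 / G) ^ j * q j) = q j * G ^ (n - j)"
        using \<open>G \<noteq> 0\<close> that by (simp add: power_diff field_simps)
      finally show ?thesis
        by (simp only: L_def mult.assoc)
    qed
    then show ?thesis
      using \<open>G \<noteq> 0\<close> by blast
  qed
  then show ?thesis
    using that unfolding n_def by blast
qed

text \<open>As G^n is a constant times x^(l-k), the exponent of x in f_j is k + (l-k)(n-j)/n.
  Clearing the denominator gives the weights n and l - k, with total weight n l.\<close>

lemma unramified_imp_quasi_homogeneous:
  assumes "unramified f" "coeff f 0 \<noteq> 0"
  shows "\<exists>\<alpha> \<beta>. quasi_homogeneous f \<alpha> \<beta> \<and> \<alpha> \<noteq> 0"
proof -
  define n where "n = degree f"
  have "lead_coeff f \<noteq> 0"
    using assms(2) by auto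
  then have "nonzero_monomial (coeff f 0)" "nonzero_monomial (lead_coeff f)"
    using assms unfolding nonzero_monomial_iff unramified_def by blast+
  then obtain c l d k where cd: "c \<noteq> 0" "coeff f 0 = monom c l" "d \<noteq> 0" "coeff f n = monom d k"
    unfolding nonzero_monomial_def n_def by blast
  show ?thesis
  proof (cases "n = 0")
    case True
    \<comment> \<open>Here f = c x^l does not involve y, so the weights 1 and 0 serve.\<close>
    have "coeff (coeff f j) i \<noteq> 0 \<Longrightarrow> int l = 1 * int i + 0 * int j" for i j
      using cd(2) True by (cases "j = 0") (auto simp: coeff_monom coeff_eq_0 n_def split: if_splits)
    then show ?thesis
      unfolding quasi_homogeneous_def by (intro exI [of _ 1] exI [of _ 0]) auto
  next
    case False
    then obtain q where q: "\<And>x. x \<noteq> 0 \<Longrightarrow> \<exists>G. G \<noteq> 0 \<and> (\<forall>j\<le>n.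
        poly (coeff f j) x = d * x ^ k * q j * G ^ (n - j))"
      using unramified_coeffs [OF assms(1)] cd(4) by (auto simp: n_def poly_monom)
    have "int n * int l = int n * int i + (int l - int k) * int j"
      if nz: "coeff (coeff f j) i \<noteq> 0" for i j
    proof -
      have j: "j \<le> n"
        using nz unfolding n_def by (intro le_degree) auto
      have "coeff f j \<noteq> 0"
        using nz by auto
      have "q j \<noteq> 0"
      proof
        assume "q j = 0"
        \<comment> \<open>The extra factor x supplies the zero at x = 0, where the relation for q
          says nothing.\<close>
        have "poly ([:0, 1:] * coeff f j) x = 0" for x
          using q [of x] j \<open>q j = 0\<close> by (cases "x = 0") auto
        with \<open>coeff f j \<noteq> 0\<close> show False
          using poly_all_0_iff_0 [of "[:0, 1:] * coeff f j"] by simp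
      qed
      then have "poly (coeff f j) x \<noteq> 0" if "x \<noteq> 0" for x
        using q [OF that] j \<open>d \<noteq> 0\<close> that by auto
      then have "nonzero_monomial (coeff f j)"
        using \<open>coeff f j \<noteq> 0\<close> by (simp add: nonzero_monomial_iff)
      then obtain e where e: "e \<noteq> 0" "coeff f j = monom e i"
        using nz by (auto simp: nonzero_monomial_def split: if_splits)
      \<comment> \<open>The n-th power of the relation for j and the (n-j)-th power of the relation
        for 0 share the factor G^(n (n-j)). Eliminating it leaves an identity of monomials in
        x.\<close>
      have "e ^ n * (d * q 0) ^ (n - j) * x ^ (n * i + k * (n - j)) =
          d ^ n * q j ^ n * c ^ (n - j) * x ^ (k * n + l * (n - j))" if x: "x \<noteq> 0" for x
      proof -
        obtain G where "\<forall>j\<le>n. poly (coeff f j) x = d * x ^ k * q j * G ^ (n - j)"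
          using q [OF x] by blast
        from this [rule_format, of 0] this [rule_format, OF j]
        have G: "c * x ^ l = d * x ^ k * q 0 * G ^ n" "e * x ^ i = d * x ^ k * q j * G ^ (n - j)"
          by (simp_all add: cd(2) e(2) poly_monom)
        have "(e * x ^ i) ^ n * (d * q 0 * x ^ k) ^ (n - j) =
            (d * x ^ k * q j) ^ n * (d * x ^ k * q 0 * G ^ n) ^ (n - j)"
          unfolding G(2) by (simp add: power_mult_distrib power_mult [symmetric] mult.commute)
        also have "\<dots> = (d * x ^ k * q j) ^ n * (c * x ^ l) ^ (n - j)"
          unfolding G(1) ..
        finally show ?thesis
          by (simp add: power_mult_distrib power_mult [symmetric] power_add mult_ac)
      qed
      moreover have "q 0 \<noteq> 0"
        using q [of 1] cd by (auto simp: poly_monom)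
      ultimately have "n * i + k * (n - j) = k * n + l * (n - j)"
        using e(1) cd(3) by (elim monomial_exponents_eq) simp
      then have "int n * int i + int k * (int n - int j) = int k * int n + int l * (int n - int j)"
        using j by (metis (no_types, lifting) of_nat_add of_nat_diff of_nat_mult)
      then show ?thesis
        by (simp add: algebra_simps)
    qed
    then show ?thesis
      unfolding quasi_homogeneous_def using False
      by (intro exI [of _ "int n"] exI [of _ "int l - int k"]) auto
  qed
qed

section \<open>Equivalence of the three conditions\<close>

theorem theorem1p2:
  fixes f :: "complex poly poly" and n :: nat and fc :: "nat \<Rightarrow> complex poly"
  assumes "f = (\<Sum>i\<le>n. monom (fc i) i)"
    and "fc 0 \<noteq> 0" and "fc n \<noteq> 0"
    and "reduced f"
  defines "A \<equiv> \<exists>\<alpha> \<beta>. quasi_homogeneous f \<alpha> \<beta> \<and> \<alpha> \<noteq> 0"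
    and "B \<equiv> nonzero_monomial (fc 0) \<and> nonzero_monomial (fc n) \<and> nonzero_monomial (Disc_y f)"
    and "C \<equiv> subvariety (multi_homogenization f)
             \<inter> subvariety ([:0, 1:] * pderiv (multi_homogenization f))
             \<inter> (cp1_Cstar \<times> UNIV) = {}"
  shows "(A \<longleftrightarrow> B) \<and> (B \<longleftrightarrow> C)"
proof -
  have coeff_f: "coeff f j = (if j \<le> n then fc j else 0)" for j
    unfolding assms(1) by (simp add: coeff_sum)
  have "degree f = n"
    using assms(3) coeff_f by (intro antisym degree_le le_degree) auto
  then have fc: "fc 0 = coeff f 0" "fc n = lead_coeff f"
    by (simp_all add: coeff_f)
  have f0: "coeff f 0 \<noteq> 0"
    using assms(2) fc by simp
  have "A \<longleftrightarrow> unramified f"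
    unfolding A_def using quasi_homogeneous_imp_unramified [OF assms(4) f0]
      unramified_imp_quasi_homogeneous [OF _ f0] by blast
  moreover have "B \<longleftrightarrow> unramified f"
    unfolding B_def fc by (rule monomials_iff_unramified [OF f0])
  moreover have "C \<longleftrightarrow> unramified f"
    unfolding C_def by (rule no_common_point_iff_unramified)
  ultimately show ?thesis by blast
qed

end
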